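(* Let $L|K$ be an algebraic field extension of finite degree $n$. Let $A$ be a normal domain with quotient field $K$ and $B$ a domain with quotient field $L$ such that $A\subset B$ is an integral extension. Suppose that there exist generators $b_\alpha\in B$ of $L|K$ (that is, $L=K(b_\alpha)$ for each $\alpha$), indexed by a totally ordered set $S$, such that $A[b_\alpha]\subset A[b_\beta]$ whenever $\alpha\le\beta$, and $$\bigcup_{\alpha\in S}A[b_\alpha]=B .$$ Suppose further that there exist nonzero elements $a_\alpha\in A$ ($\alpha\in S$) such that $a_\beta\mid a_\alpha$ in $A$ whenever $\alpha\le\beta$, and that for all $\alpha\le\beta$ there exist $c_{\alpha,\beta}\in A$ with $$b_\alpha=\frac{a_\alpha}{a_\beta}\,b_\beta+c_{\alpha,\beta}.$$ Let $h_\alpha$ be the minimal polynomial of $b_\alpha$ over $K$, with derivative $h_\alpha'$. Let $U$ and $V$ be the $B$-ideals $$U=(a_\alpha\mid\alpha\in S),\qquad V=(h_\alpha'(b_\alpha)\mid\alpha\in S).$$ Then there is a $B$-module isomorphism $$\Omega_{B|A}\cong U/UV .$$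
   Context: $\Omega_{B|A}$ denotes the module of Kähler differentials (relative differentials) of the $A$-algebra $B$. "Normal domain" means integrally closed in its quotient field. For a family of elements of $B$, $(\,\cdot\,)$ denotes the $B$-ideal generated by it. *)

theory Defs
  imports "HOL-Algebra.Algebra" "HOL-Algebra.Algebraic_Closure_Type"
begin

section \<open>Modules over a commutative ring\<close>

text \<open>
  The record type \<^typ>\<open>('a, 'm) module\<close> extends \<^typ>\<open>'m ring\<close>, so a module record also has
  fields \<^const>\<open>monoid.mult\<close> and \<^const>\<open>monoid.one\<close>. The locale \<^locale>\<open>module\<close> ignores them; they are
  filled below with arbitrary values.
\<close>

definition free_module :: "('a, 'r) ring_scheme \<Rightarrow> 'i set \<Rightarrow> ('a, 'i \<Rightarrow> 'a) module" where
  "free_module R I =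
    \<lparr>carrier = {f. (\<forall>i\<in>I. f i \<in> carrier R) \<and> (\<forall>i. i \<notin> I \<longrightarrow> f i = \<zero>\<^bsub>R\<^esub>) \<and> finite {i. f i \<noteq> \<zero>\<^bsub>R\<^esub>}},
     monoid.mult = undefined, monoid.one = undefined,
     ring.zero = (\<lambda>i. \<zero>\<^bsub>R\<^esub>), ring.add = (\<lambda>f g i. f i \<oplus>\<^bsub>R\<^esub> g i),
     module.smult = (\<lambda>r f i. r \<otimes>\<^bsub>R\<^esub> f i)\<rparr>"

definition free_gen :: "('a, 'r) ring_scheme \<Rightarrow> 'i \<Rightarrow> 'i \<Rightarrow> 'a" where
  "free_gen R i = (\<lambda>j. if j = i then \<one>\<^bsub>R\<^esub> else \<zero>\<^bsub>R\<^esub>)"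

definition submodule_gen :: "('a, 'r) ring_scheme \<Rightarrow> ('a, 'm, 'z) module_scheme \<Rightarrow> 'm set \<Rightarrow> 'm set" where
  "submodule_gen R M G = \<Inter>{N. submodule N R M \<and> G \<subseteq> N}"

definition quot_module :: "('a, 'm, 'z) module_scheme \<Rightarrow> 'm set \<Rightarrow> ('a, 'm set) module" where
  "quot_module M N =
    \<lparr>carrier = a_rcosets\<^bsub>M\<^esub> N, monoid.mult = undefined, monoid.one = undefined,
     ring.zero = N, ring.add = set_add M,
     module.smult = (\<lambda>r C. \<Union>x\<in>C. N +>\<^bsub>M\<^esub> (r \<odot>\<^bsub>M\<^esub> x))\<rparr>"

definition ideal_module :: "('a, 'r) ring_scheme \<Rightarrow> 'a set \<Rightarrow> ('a, 'a) module" where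
  "ideal_module R I =
    \<lparr>carrier = I, monoid.mult = undefined, monoid.one = undefined,
     ring.zero = \<zero>\<^bsub>R\<^esub>, ring.add = ring.add R, module.smult = monoid.mult R\<rparr>"

definition module_isomorphic ::
  "('a, 'r) ring_scheme \<Rightarrow> ('a, 'm, 'y) module_scheme \<Rightarrow> ('a, 'n, 'z) module_scheme \<Rightarrow> bool" where
  "module_isomorphic R M N \<longleftrightarrow>
    (\<exists>f \<in> iso (add_monoid M) (add_monoid N).
       \<forall>r\<in>carrier R. \<forall>x\<in>carrier M. f (r \<odot>\<^bsub>M\<^esub> x) = r \<odot>\<^bsub>N\<^esub> f x)"

lemma free_module_is_module:
  assumes "cring R" shows "module R (free_module R I)"
proof -
  interpret cring R by fact
  have fin: "finite {i. f i \<oplus>\<^bsub>R\<^esub> g i \<noteq> \<zero>\<^bsub>R\<^esub>}" if "finite {i. f i \<noteq> \<zero>\<^bsub>R\<^esub>}" "finite {i. g i \<noteq> \<zero>\<^bsub>R\<^esub>}"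
    for f g :: "'c \<Rightarrow> 'a"
    by (rule finite_subset[OF _ finite_UnI[OF that]]) auto
  have fin': "finite {i. r \<otimes>\<^bsub>R\<^esub> f i \<noteq> \<zero>\<^bsub>R\<^esub>}" if "finite {i. f i \<noteq> \<zero>\<^bsub>R\<^esub>}" "r \<in> carrier R" for r and f :: "'c \<Rightarrow> 'a"
    by (rule finite_subset[OF _ that(1)]) (use that in auto)
  have fin'': "finite {i. \<ominus>\<^bsub>R\<^esub> f i \<noteq> \<zero>\<^bsub>R\<^esub>}" if "finite {i. f i \<noteq> \<zero>\<^bsub>R\<^esub>}" for f :: "'c \<Rightarrow> 'a"
    by (rule finite_subset[OF _ that(1)]) auto
  have cl: "f i \<in> carrier R" if "f \<in> carrier (free_module R I)" for f :: "'c \<Rightarrow> 'a" and i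
    using that by (cases "i \<in> I") (auto simp: free_module_def)
  have mem: "f \<in> carrier (free_module R I) \<longleftrightarrow>
      (\<forall>i. f i \<in> carrier R) \<and> (\<forall>i. i \<notin> I \<longrightarrow> f i = \<zero>\<^bsub>R\<^esub>) \<and> finite {i. f i \<noteq> \<zero>\<^bsub>R\<^esub>}" for f
    using cl[of f] by (auto simp: free_module_def)
  have ops: "ring.add (free_module R I) f g = (\<lambda>i. f i \<oplus>\<^bsub>R\<^esub> g i)" "ring.zero (free_module R I) = (\<lambda>i. \<zero>\<^bsub>R\<^esub>)"
    "module.smult (free_module R I) r f = (\<lambda>i. r \<otimes>\<^bsub>R\<^esub> f i)" for r f g
    by (simp_all add: free_module_def)
  show ?thesis
  proof (intro moduleI abelian_groupI)
    show "\<exists>y\<in>carrier (free_module R I). y \<oplus>\<^bsub>free_module R I\<^esub> f = \<zero>\<^bsub>free_module R I\<^esub>"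
      if "f \<in> carrier (free_module R I)" for f
      by (rule bexI[of _ "\<lambda>i. \<ominus>\<^bsub>R\<^esub> f i"]) (use that in \<open>auto simp: mem ops fin'' l_neg\<close>)
  qed (unfold mem ops, auto simp: fin fin' is_cring a_ac m_ac l_distr r_distr)
qed

lemma quot_module_is_module:
  assumes "module R M" "submodule N R M" shows "module R (quot_module M N)"
proof -
  interpret module R M by fact
  interpret S: submodule N R M by fact
  have N: "N \<subseteq> carrier M" using S.subset by simp
  have asub: "additive_subgroup N M" by (rule additive_subgroup.intro[OF S.subgroup_axioms])
  interpret asg: abelian_subgroup N M
    by (rule abelian_subgroupI3[OF asub M.abelian_group_axioms])
  have add: "(N +>\<^bsub>M\<^esub> x) <+>\<^bsub>M\<^esub> (N +>\<^bsub>M\<^esub> y) = N +>\<^bsub>M\<^esub> (x \<oplus>\<^bsub>M\<^esub> y)"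
    if "x \<in> carrier M" "y \<in> carrier M" for x y using that by (rule asg.a_rcos_sum)
  have smult: "(\<Union>z\<in>N +>\<^bsub>M\<^esub> x. N +>\<^bsub>M\<^esub> (r \<odot>\<^bsub>M\<^esub> z)) = N +>\<^bsub>M\<^esub> (r \<odot>\<^bsub>M\<^esub> x)"
    if r: "r \<in> carrier R" and x: "x \<in> carrier M" for r x
  proof -
    have "N +>\<^bsub>M\<^esub> (r \<odot>\<^bsub>M\<^esub> z) = N +>\<^bsub>M\<^esub> (r \<odot>\<^bsub>M\<^esub> x)" if "z \<in> N +>\<^bsub>M\<^esub> x" for z
    proof -
      obtain h where h: "h \<in> N" "z = h \<oplus>\<^bsub>M\<^esub> x" using \<open>z \<in> _\<close> by (auto simp: a_r_coset_def')
      have "r \<odot>\<^bsub>M\<^esub> z = r \<odot>\<^bsub>M\<^esub> h \<oplus>\<^bsub>M\<^esub> r \<odot>\<^bsub>M\<^esub> x" using h r x N by (auto simp: smult_r_distr)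
      then have "r \<odot>\<^bsub>M\<^esub> z \<in> N +>\<^bsub>M\<^esub> (r \<odot>\<^bsub>M\<^esub> x)" using h r by (auto simp: a_r_coset_def')
      then show ?thesis using M.a_repr_independence[OF _ _ S.subgroup_axioms] r x by simp
    qed
    moreover have "x \<in> N +>\<^bsub>M\<^esub> x" using x by (rule asg.a_rcos_self)
    ultimately show ?thesis by (intro SUP_eq_const) blast+
  qed
  have zero: "N = N +>\<^bsub>M\<^esub> \<zero>\<^bsub>M\<^esub>" using N by simp
  have carr: "carrier (quot_module M N) = (\<lambda>x. N +>\<^bsub>M\<^esub> x) ` carrier M"
    by (auto simp: quot_module_def A_RCOSETS_def')
  have ex: "\<exists>y\<in>carrier M. N +>\<^bsub>M\<^esub> (y \<oplus>\<^bsub>M\<^esub> x) = N" if "x \<in> carrier M" for x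
    by (rule bexI[of _ "\<ominus>\<^bsub>M\<^esub> x"]) (use that N in \<open>auto simp: M.l_neg\<close>)
  have ex': "\<exists>y\<in>carrier M. N +>\<^bsub>M\<^esub> (x \<oplus>\<^bsub>M\<^esub> y) = N" if "x \<in> carrier M" for x
    by (rule bexI[of _ "\<ominus>\<^bsub>M\<^esub> x"]) (use that N in \<open>auto simp: M.r_neg\<close>)
  have ops: "ring.add (quot_module M N) = set_add M" "ring.zero (quot_module M N) = N"
    by (simp_all add: quot_module_def)
  have smult': "r \<odot>\<^bsub>quot_module M N\<^esub> (N +>\<^bsub>M\<^esub> x) = N +>\<^bsub>M\<^esub> (r \<odot>\<^bsub>M\<^esub> x)"
    if "r \<in> carrier R" "x \<in> carrier M" for r x
    using smult[OF that] by (simp add: quot_module_def)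
  show ?thesis
  proof (intro moduleI abelian_groupI)
    show "\<zero>\<^bsub>quot_module M N\<^esub> \<oplus>\<^bsub>quot_module M N\<^esub> x = x" if "x \<in> carrier (quot_module M N)" for x
      using that unfolding carr ops by (subst zero) (auto simp: add simp del: M.a_coset_add_zero)
    show "\<zero>\<^bsub>quot_module M N\<^esub> \<in> carrier (quot_module M N)"
      unfolding carr ops using zero by blast
  qed (auto simp: carr ops add smult' smult_l_distr smult_r_distr smult_assoc1 M.a_ac ex ex' is_cring)
qed

lemma submodule_gen_is_submodule:
  assumes "module R M" "G \<subseteq> carrier M" shows "submodule (submodule_gen R M G) R M"
proof -
  interpret module R M by fact
  show ?thesis
  proof (rule submoduleI)
    show "submodule_gen R M G \<subseteq> carrier M"
      using carrier_is_submodule assms(2) by (auto simp: submodule_gen_def)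
    show "\<zero>\<^bsub>M\<^esub> \<in> submodule_gen R M G"
      by (auto simp: submodule_gen_def dest!: submodule.axioms(1) subgroup.one_closed)
    show "a \<oplus>\<^bsub>M\<^esub> b \<in> submodule_gen R M G" if "a \<in> submodule_gen R M G" "b \<in> submodule_gen R M G" for a b
      using that submoduleE(5) by (auto simp: submodule_gen_def)
    show "\<ominus>\<^bsub>M\<^esub> a \<in> submodule_gen R M G" if "a \<in> submodule_gen R M G" for a
      using that submoduleE(3) by (auto simp: submodule_gen_def)
    show "a \<odot>\<^bsub>M\<^esub> x \<in> submodule_gen R M G" if "a \<in> carrier R" "x \<in> submodule_gen R M G" for a x
      using that submoduleE(4) by (auto simp: submodule_gen_def)
  qed
qed

lemma ideal_module_is_module:
  assumes "cring R" "ideal I R" shows "module R (ideal_module R I)"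
proof -
  interpret cring R by fact
  interpret ideal I R by fact
  show ?thesis
  proof (intro moduleI abelian_groupI)
    show "\<exists>y\<in>carrier (ideal_module R I). y \<oplus>\<^bsub>ideal_module R I\<^esub> x = \<zero>\<^bsub>ideal_module R I\<^esub>"
      if "x \<in> carrier (ideal_module R I)" for x
      by (rule bexI[of _ "\<ominus>\<^bsub>R\<^esub> x"]) (use that Icarr in \<open>auto simp: ideal_module_def l_neg\<close>)
  qed (use Icarr in \<open>auto simp: ideal_module_def is_cring a_ac m_ac l_distr r_distr I_l_closed\<close>)
qed

lemma ideal_prod_is_submodule:
  assumes "cring R" "ideal I R" "ideal J R" shows "submodule (ideal_prod R I J) R (ideal_module R I)"
proof -
  interpret cring R by fact
  interpret M: module R "ideal_module R I" by (rule ideal_module_is_module) fact+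
  interpret P: ideal "ideal_prod R I J" R by (rule ideal_prod_is_ideal) fact+
  have "ideal_prod R I J \<subseteq> I" using ideal_prod_inter[OF assms(2,3)] by blast
  moreover have "\<ominus>\<^bsub>ideal_module R I\<^esub> x = \<ominus>\<^bsub>R\<^esub> x" if "x \<in> I" for x
    using that ideal.Icarr[OF assms(2)] additive_subgroup.a_inv_closed[OF ideal.axioms(1)[OF assms(2)]]
    by (intro M.minus_equality) (auto simp: ideal_module_def l_neg)
  ultimately show ?thesis
    by (intro M.submoduleI) (auto simp: ideal_module_def P.I_l_closed)
qed


section \<open>Kaehler differentials\<close>

text \<open>
  For a commutative ring \<open>R\<close> and a subring \<open>A\<close>: the \<open>R\<close>-module on generators \<open>d x\<close> (\<open>x \<in> R\<close>) with
  relations \<open>d (x + y) = d x + d y\<close>, \<open>d (x y) = x d y + y d x\<close> and \<open>d a = 0\<close> for \<open>a \<in> A\<close>.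
\<close>

definition kaehler_relations :: "('a, 'r) ring_scheme \<Rightarrow> 'a set \<Rightarrow> ('a \<Rightarrow> 'a) set" where
  "kaehler_relations R A =
    (let F = free_module R (carrier R); d = free_gen R in
      {d (x \<oplus>\<^bsub>R\<^esub> y) \<ominus>\<^bsub>F\<^esub> (d x \<oplus>\<^bsub>F\<^esub> d y) | x y. x \<in> carrier R \<and> y \<in> carrier R} \<union>
      {d (x \<otimes>\<^bsub>R\<^esub> y) \<ominus>\<^bsub>F\<^esub> (x \<odot>\<^bsub>F\<^esub> d y \<oplus>\<^bsub>F\<^esub> y \<odot>\<^bsub>F\<^esub> d x) | x y. x \<in> carrier R \<and> y \<in> carrier R} \<union>
      d ` A)"

definition kaehler :: "('a, 'r) ring_scheme \<Rightarrow> 'a set \<Rightarrow> ('a, ('a \<Rightarrow> 'a) set) module" where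
  "kaehler R A =
    (let F = free_module R (carrier R)
     in quot_module F (submodule_gen R F (kaehler_relations R A)))"

lemma kaehler_is_module:
  assumes "cring R" "A \<subseteq> carrier R" shows "module R (kaehler R A)"
proof -
  interpret cring R by fact
  interpret F: module R "free_module R (carrier R)" by (rule free_module_is_module) fact
  have "free_gen R x \<in> carrier (free_module R (carrier R))" if "x \<in> carrier R" for x
    using that by (auto simp: free_gen_def free_module_def)
  then have "kaehler_relations R A \<subseteq> carrier (free_module R (carrier R))"
    using assms(2) by (auto simp: kaehler_relations_def Let_def intro!: F.minus_closed F.M.add.m_closed F.smult_closed)
  then show ?thesis
    unfolding kaehler_def Let_def
    by (intro quot_module_is_module submodule_gen_is_submodule F.module_axioms)
qed


section \<open>Quotient fields, integrality, minimal polynomials\<close>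

text \<open>The quotient field, inside the field \<open>L\<close>, of a subdomain \<open>A\<close> of \<open>L\<close>.\<close>

definition quotient_field :: "('a, 'r) ring_scheme \<Rightarrow> 'a set \<Rightarrow> 'a set" where
  "quotient_field L A = {x \<otimes>\<^bsub>L\<^esub> inv\<^bsub>L\<^esub> y | x y. x \<in> A \<and> y \<in> A \<and> y \<noteq> \<zero>\<^bsub>L\<^esub>}"

definition integral_over :: "('a, 'r) ring_scheme \<Rightarrow> 'a set \<Rightarrow> 'a \<Rightarrow> bool" where
  "integral_over L A x \<longleftrightarrow>
    (\<exists>p \<in> carrier (A [X]\<^bsub>L\<^esub>). p \<noteq> [] \<and> Polynomials.lead_coeff p = \<one>\<^bsub>L\<^esub> \<and> ring.eval L p x = \<zero>\<^bsub>L\<^esub>)"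

definition normal_subdomain :: "('a, 'r) ring_scheme \<Rightarrow> 'a set \<Rightarrow> bool" where
  "normal_subdomain L A \<longleftrightarrow>
    subdomain A L \<and> (\<forall>x \<in> quotient_field L A. integral_over L A x \<longrightarrow> x \<in> A)"

text \<open>
  The minimal polynomial over a subfield \<open>K\<close> of a type-class field. \<^const>\<open>ring.Irr\<close> yields it as a
  coefficient list with the leading coefficient first, whereas \<^const>\<open>Poly\<close> expects the constant
  coefficient first.
\<close>

definition minimal_poly :: "'l::field set \<Rightarrow> 'l \<Rightarrow> 'l poly" where
  "minimal_poly K x = Poly (rev (ring.Irr ring_of_type_algebra K x))"

lemma poly_Poly_rev:
  "poly (Poly (rev p)) x = ring.eval ring_of_type_algebra p (x :: 'l::field)"
proof -
  interpret field "ring_of_type_algebra :: 'l ring" by (rule field_from_type_algebra)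
  have pow: "x [^]\<^bsub>ring_of_type_algebra\<^esub> k = x ^ k" for k :: nat
    by (induction k) (auto simp: ring_of_type_algebra_def)
  show ?thesis
    by (induction p) (simp_all add: pow Poly_append poly_monom, simp_all add: ring_of_type_algebra_def)
qed

end

theory Submission
  imports Defs "Jordan_Normal_Form.Char_Poly"
begin

text \<open>
  For a single generator \<open>b\<close> with minimal polynomial \<open>h\<close> over \<open>A\<close>, the ring \<open>A[b]\<close> is \<open>A[X] / (h)\<close>. Its
  differentials are generated by \<open>d b\<close>, and the only relation is \<open>h'(b) d b = 0\<close>. In the situation of
  the theorem \<open>B\<close> is the directed union of rings \<open>A[b \<alpha>]\<close>. Since \<open>b \<alpha> = (a \<alpha> / a \<beta>) b \<beta> + c\<close> with \<open>c\<close> in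
  \<open>A\<close>, the differentials satisfy \<open>d (b \<alpha>) = (a \<alpha> / a \<beta>) d (b \<beta>)\<close> for \<open>\<alpha> \<le> \<beta>\<close>. These are the relations
  \<open>a \<alpha> = (a \<alpha> / a \<beta>) a \<beta>\<close> that hold between the generators of \<open>U\<close>, so \<open>d (b \<alpha>)\<close> should correspond to
  \<open>a \<alpha>\<close>, and the relations \<open>h'(b \<alpha>) d (b \<alpha>) = 0\<close> should correspond to dividing by \<open>UV\<close>.

  Because of the divisibilities \<open>a \<beta> dvd a \<alpha>\<close> the ideal \<open>U\<close> is the directed union of the principal ideals
  \<open>B a \<alpha>\<close>. The values \<open>h'(b \<alpha>)\<close> divide each other in the same direction (\<open>different_multiple\<close>), so
  \<open>V\<close> is the directed union of the \<open>B h'(b \<alpha>)\<close>, and \<open>UV\<close> that of the \<open>B a \<alpha> h'(b \<alpha>)\<close>. Thus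
  every statement about these ideals reduces to a statement at one sufficiently large index.

  The map from the differentials to \<open>U / UV\<close> is induced by the derivation \<open>f(b \<alpha>) \<mapsto> f'(b \<alpha>) a \<alpha>\<close> for \<open>f\<close>
  in \<open>A[X]\<close>. Its value does not depend on \<open>\<alpha>\<close> by the chain rule (\<open>raise_index\<close>). It does not depend on
  \<open>f\<close> modulo \<open>UV\<close> because an \<open>f\<close> that vanishes at \<open>b \<alpha>\<close> is a multiple of \<open>h\<close> in \<open>A[X]\<close>
  (\<open>pderiv_root_in_W\<close>). This needs \<open>h\<close> to have coefficients in \<open>A\<close>, which follows from normality:
  the roots of \<open>h\<close> in an algebraic closure are integral over \<open>A\<close>, the integral elements form a ring, so
  the coefficients of \<open>h\<close> are integral over \<open>A\<close> and lie in the quotient field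
  (\<open>minimal_poly_in_polys_over_normal\<close>). The map is onto because \<open>d (b \<alpha>)\<close> goes to \<open>a \<alpha>\<close>. For
  injectivity, every differential is a multiple \<open>r d (b \<beta>)\<close> (\<open>reduce_to_dgen_b\<close>). If \<open>r a \<beta>\<close> lies in \<open>UV\<close>, it
  equals \<open>s a \<delta> h'(b \<delta>)\<close> for some \<open>\<delta> \<ge> \<beta>\<close>, and then \<open>r d (b \<beta>) = s h'(b \<delta>) d (b \<delta>) = 0\<close>
  (\<open>dgen_b_in_N\<close>).
\<close>

section \<open>Subrings and polynomials with coefficients in them\<close>

locale type_subring =
  fixes A :: "'a::comm_ring_1 set"
  assumes one_in [simp, intro]: "1 \<in> A"
    and diff_in [intro]: "\<And>x y. x \<in> A \<Longrightarrow> y \<in> A \<Longrightarrow> x - y \<in> A"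
    and mult_in [intro]: "\<And>x y. x \<in> A \<Longrightarrow> y \<in> A \<Longrightarrow> x * y \<in> A"
begin

lemma zero_in [simp, intro]: "0 \<in> A"
  using diff_in[OF one_in one_in] by simp

lemma uminus_in [intro]: "x \<in> A \<Longrightarrow> - x \<in> A"
  using diff_in[OF zero_in] by force

lemma add_in [intro]: "x \<in> A \<Longrightarrow> y \<in> A \<Longrightarrow> x + y \<in> A"
  using diff_in[of x "- y"] uminus_in by force

lemma sum_in: "(\<And>i. i \<in> I \<Longrightarrow> f i \<in> A) \<Longrightarrow> sum f I \<in> A"
  by (induction I rule: infinite_finite_induct) auto

lemma prod_in: "(\<And>i. i \<in> I \<Longrightarrow> f i \<in> A) \<Longrightarrow> prod f I \<in> A"
  by (induction I rule: infinite_finite_induct) auto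

lemma power_in [intro]: "x \<in> A \<Longrightarrow> x ^ n \<in> A"
  by (induction n) auto

lemma of_nat_in [simp, intro]: "of_nat n \<in> A"
  by (induction n) auto

end

definition polys_over :: "'a::zero set \<Rightarrow> 'a poly set" where
  "polys_over A = {p. \<forall>i. poly.coeff p i \<in> A}"

lemma polys_over_coeff: "p \<in> polys_over A \<Longrightarrow> poly.coeff p i \<in> A"
  by (simp add: polys_over_def)

lemma polys_over_mono: "A \<subseteq> B \<Longrightarrow> p \<in> polys_over A \<Longrightarrow> p \<in> polys_over B"
  by (auto simp: polys_over_def)

context type_subring
begin

lemma polys_over_subring: "type_subring (polys_over A)"
  by unfold_locales (auto simp: polys_over_def coeff_mult coeff_1 intro!: sum_in)

lemma pCons_in_polys_over [simp]: "pCons c p \<in> polys_over A \<longleftrightarrow> c \<in> A \<and> p \<in> polys_over A"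
  unfolding polys_over_def by (auto simp: coeff_pCons split: nat.splits)

lemma zero_in_polys_over [simp]: "0 \<in> polys_over A"
  by (simp add: polys_over_def)

lemma monom_in_polys_over: "c \<in> A \<Longrightarrow> Polynomial.monom c n \<in> polys_over A"
  by (auto simp: polys_over_def)

lemma poly_in: "p \<in> polys_over A \<Longrightarrow> x \<in> A \<Longrightarrow> poly p x \<in> A"
  by (induction p) auto

lemma pcompose_in_polys_over:
  assumes "p \<in> polys_over A" "q \<in> polys_over A"
  shows "pcompose p q \<in> polys_over A"
proof -
  interpret P: type_subring "polys_over A" by (rule polys_over_subring)
  show ?thesis
    using assms by (induction p) (auto simp: pcompose_pCons)
qed

text \<open>
  Division by a monic polynomial needs no division of coefficients: the leading term of the
  dividend is removed by subtracting a monomial multiple of the divisor.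
\<close>

lemma monic_division_in_polys_over:
  assumes h: "h \<in> polys_over A" "Polynomial.lead_coeff h = 1" "Polynomial.degree h > 0"
    and f: "f \<in> polys_over A"
  shows "\<exists>q\<in>polys_over A. \<exists>r\<in>polys_over A. f = q * h + r \<and> Polynomial.degree r < Polynomial.degree h"
  using f
proof (induction "Polynomial.degree f" arbitrary: f rule: less_induct)
  case less
  interpret P: type_subring "polys_over A" by (rule polys_over_subring)
  show ?case
  proof (cases "Polynomial.degree f < Polynomial.degree h")
    case True
    then show ?thesis using less.prems by (intro bexI[of _ 0] bexI[of _ f]) auto
  next
    case False
    define c where "c = Polynomial.monom (Polynomial.lead_coeff f) (Polynomial.degree f - Polynomial.degree h)"
    have c: "c \<in> polys_over A"
      unfolding c_def using less.prems by (intro monom_in_polys_over polys_over_coeff)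
    have f0: "f \<noteq> 0" using False h(3) by auto
    have "Polynomial.degree (f - c * h) < Polynomial.degree f"
    proof -
      have "Polynomial.degree (c * h) \<le> Polynomial.degree c + Polynomial.degree h"
        by (rule degree_mult_le)
      also have "\<dots> \<le> Polynomial.degree f"
        using False degree_monom_le[of "Polynomial.lead_coeff f" "Polynomial.degree f - Polynomial.degree h"] by (simp add: c_def)
      finally have "Polynomial.degree (f - c * h) \<le> Polynomial.degree f"
        by (simp add: degree_diff_le)
      moreover have "poly.coeff (c * h) (Polynomial.degree f) = Polynomial.lead_coeff f"
        using False h(2) by (simp add: c_def coeff_monom_mult)
      then have "poly.coeff (f - c * h) (Polynomial.degree f) = 0" by simp
      moreover have "Polynomial.degree f \<noteq> 0" using False h(3) by simp
      ultimately show ?thesis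
        by (metis leading_coeff_0_iff le_neq_implies_less degree_0 bot_nat_0.not_eq_extremum)
    qed
    from less.hyps[OF this] obtain q r where "q \<in> polys_over A" "r \<in> polys_over A"
      "f - c * h = q * h + r" "Polynomial.degree r < Polynomial.degree h"
      using c h(1) less.prems by blast
    then show ?thesis using c by (intro bexI[of _ "q + c"] bexI[of _ r]) (auto simp: algebra_simps)
  qed
qed

end

lemma pderiv_in_polys_over:
  fixes A :: "'a::idom set"
  assumes "type_subring A" "p \<in> polys_over A"
  shows "pderiv p \<in> polys_over A"
proof -
  interpret type_subring A by fact
  show ?thesis
    using assms(2) unfolding polys_over_def by (auto simp: coeff_pderiv simp del: of_nat_Suc)
qed

section \<open>Integral elements\<close>

definition integral_elem :: "'a::comm_ring_1 set \<Rightarrow> 'a \<Rightarrow> bool" where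
  "integral_elem A x \<longleftrightarrow> (\<exists>p\<in>polys_over A. Polynomial.lead_coeff p = 1 \<and> poly p x = 0)"

definition lin_combs :: "'a::comm_ring_1 set \<Rightarrow> 'i set \<Rightarrow> ('i \<Rightarrow> 'a) \<Rightarrow> 'a set" where
  "lin_combs A I v = {\<Sum>i\<in>I. c i * v i | c. \<forall>i. c i \<in> A}"

context type_subring
begin

lemma lin_combs_zero [simp]: "0 \<in> lin_combs A I v"
  by (auto simp: lin_combs_def intro!: exI[of _ "\<lambda>_. 0"])

lemma lin_combs_add: "x \<in> lin_combs A I v \<Longrightarrow> y \<in> lin_combs A I v \<Longrightarrow> x + y \<in> lin_combs A I v"
  unfolding lin_combs_def
  by clarify (rule_tac x = "\<lambda>i. c i + ca i" in exI, auto simp: distrib_right sum.distrib)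

lemma lin_combs_scale: "c \<in> A \<Longrightarrow> x \<in> lin_combs A I v \<Longrightarrow> c * x \<in> lin_combs A I v"
  unfolding lin_combs_def
  by clarify (rule_tac x = "\<lambda>i. c * ca i" in exI, auto simp: sum_distrib_left mult.assoc)

lemma lin_combs_sum: "(\<And>j. j \<in> J \<Longrightarrow> f j \<in> lin_combs A I v) \<Longrightarrow> sum f J \<in> lin_combs A I v"
  by (induction J rule: infinite_finite_induct) (auto intro: lin_combs_add)

lemma lin_combs_gen:
  assumes "finite I" "i \<in> I"
  shows "v i \<in> lin_combs A I v"
proof -
  have "(\<Sum>j\<in>I. (if j = i then 1 else 0) * v j) = (\<Sum>j\<in>I. if j = i then v j else 0)"
    by (intro sum.cong) auto
  also have "\<dots> = v i" using assms by simp
  finally show ?thesis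
    unfolding lin_combs_def by (auto intro!: exI[of _ "\<lambda>j. if j = i then 1 else 0"])
qed

lemma lin_combs_mult:
  assumes "\<And>i. i \<in> I \<Longrightarrow> z * v i \<in> lin_combs A J w" "x \<in> lin_combs A I v"
  shows "z * x \<in> lin_combs A J w"
proof -
  from assms(2) obtain c where c: "x = (\<Sum>i\<in>I. c i * v i)" "\<And>i. c i \<in> A"
    by (auto simp: lin_combs_def)
  have "z * x = (\<Sum>i\<in>I. c i * (z * v i))"
    by (simp add: c sum_distrib_left mult_ac)
  also have "\<dots> \<in> lin_combs A J w" using assms(1) c(2) by (simp add: lin_combs_sum lin_combs_scale)
  finally show ?thesis .
qed

end

text \<open>
  The determinant trick: if multiplication by \<open>z\<close> maps each of finitely many elements \<open>v i\<close> to a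
  combination of them with coefficients in \<open>A\<close>, then \<open>z\<close> is an eigenvalue of the matrix of these
  coefficients, hence a root of its characteristic polynomial, which is monic over \<open>A\<close>.
\<close>

lemma integral_elem_if_stable_span:
  fixes A :: "'a::field set" and v :: "nat \<Rightarrow> 'a"
  assumes "type_subring A" and v: "k < n" "v k \<noteq> 0"
    and stable: "\<And>i. i < n \<Longrightarrow> z * v i \<in> lin_combs A {..<n} v"
  shows "integral_elem A z"
proof -
  interpret type_subring A by fact
  interpret P: type_subring "polys_over A" by (rule polys_over_subring)
  have "\<forall>i. \<exists>c. i < n \<longrightarrow> z * v i = (\<Sum>j<n. c j * v j) \<and> (\<forall>j. c j \<in> A)"
    using stable by (fastforce simp: lin_combs_def)
  then obtain c where c: "\<And>i. i < n \<Longrightarrow> z * v i = (\<Sum>j<n. c i j * v j)"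
    "\<And>i j. i < n \<Longrightarrow> c i j \<in> A" by metis
  define M where "M = mat n n (\<lambda>(i, j). c i j)"
  have M: "M \<in> carrier_mat n n" by (simp add: M_def)
  have "eigenvector M (vec n v) z"
    unfolding eigenvector_def
  proof (intro conjI)
    show "vec n v \<noteq> 0\<^sub>v (dim_row M)"
      using v M by (metis carrier_matD(1) index_vec index_zero_vec(1))
    show "M *\<^sub>v vec n v = z \<cdot>\<^sub>v vec n v"
      by (rule eq_vecI) (auto simp: M_def scalar_prod_def c(1) lessThan_atLeast0)
  qed (use M in auto)
  then have "poly (char_poly M) z = 0"
    using eigenvalue_root_char_poly[OF M] by (auto simp: eigenvalue_def)
  moreover have "Polynomial.lead_coeff (char_poly M) = 1"
    using degree_monic_char_poly[OF M] by simp
  moreover have "char_poly M \<in> polys_over A"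
  proof -
    have "char_poly_matrix M $$ (i, j) \<in> polys_over A" if "i < n" "j < n" for i j
      using that c(2) by (auto simp: char_poly_matrix_def M_def)
    moreover have "signof p \<in> polys_over A" for p :: "nat \<Rightarrow> nat"
      using P.one_in P.uminus_in[OF P.one_in] by (auto simp: sign_def)
    ultimately show ?thesis
      unfolding char_poly_def det_def'[OF char_poly_matrix_closed[OF M]]
      by (auto intro!: P.sum_in P.mult_in P.prod_in simp: permutes_in_image)
  qed
  ultimately show ?thesis by (auto simp: integral_elem_def)
qed

text \<open>
  The monic equation of \<open>x\<close> rewrites every power \<open>x ^ i\<close> with \<open>i\<close> at least the degree in terms of
  smaller powers.
\<close>

lemma integral_elem_powers_span:
  assumes "type_subring A" "p \<in> polys_over A" "Polynomial.lead_coeff p = 1" "poly p x = 0"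
  shows "x ^ i \<in> lin_combs A {..<Polynomial.degree p} (\<lambda>i. x ^ i)"
proof (induction i rule: less_induct)
  case (less i)
  interpret type_subring A by fact
  let ?n = "Polynomial.degree p"
  show ?case
  proof (cases "i < ?n")
    case False
    have "0 = x ^ (i - ?n) * poly p x" using assms(4) by simp
    also have "\<dots> = x ^ (i - ?n) * ((\<Sum>j<?n. poly.coeff p j * x ^ j) + x ^ ?n)"
      using assms(3) by (simp add: poly_altdef flip: lessThan_Suc_atMost)
    also have "\<dots> = (\<Sum>j<?n. poly.coeff p j * x ^ (i - ?n + j)) + x ^ i"
      using False by (simp add: algebra_simps sum_distrib_left flip: power_add)
    finally have "x ^ i = (\<Sum>j<?n. - poly.coeff p j * x ^ (i - ?n + j))"
      by (simp add: sum_negf eq_neg_iff_add_eq_0 add.commute)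
    also have "\<dots> \<in> lin_combs A {..<?n} (\<lambda>i. x ^ i)"
      using False assms(2) by (intro lin_combs_sum lin_combs_scale less uminus_in polys_over_coeff) auto
    finally show ?thesis .
  qed (auto intro: lin_combs_gen)
qed

text \<open>
  All monomials in two integral elements \<open>x\<close>, \<open>y\<close> lie in the span of the finitely many
  \<open>x ^ i * y ^ j\<close> with \<open>i\<close>, \<open>j\<close> below the degrees of the two monic equations, so the determinant trick
  applies to every \<open>z\<close> that maps monomials to monomials or to sums of two of them. The hypothesis on
  \<open>z\<close> has this form to cover \<open>x + y\<close> and \<open>x * y\<close> at once.
\<close>

lemma integral_elem_if_stable_monomials:
  fixes A :: "'a::field set"
  assumes A: "type_subring A" and x: "integral_elem A x" and y: "integral_elem A y"
    and z: "\<And>i j. z * (x ^ i * y ^ j) = x ^ f i * y ^ g j + x ^ f' i * y ^ g' j \<or>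
                   z * (x ^ i * y ^ j) = x ^ f i * y ^ g j"
  shows "integral_elem A z"
proof -
  interpret type_subring A by fact
  from x obtain p where p: "p \<in> polys_over A" "Polynomial.lead_coeff p = 1" "poly p x = 0"
    by (auto simp: integral_elem_def)
  from y obtain q where q: "q \<in> polys_over A" "Polynomial.lead_coeff q = 1" "poly q y = 0"
    by (auto simp: integral_elem_def)
  define m n where "m = Polynomial.degree p" and "n = Polynomial.degree q"
  \<comment> \<open>the monomials \<open>x ^ i * y ^ j\<close> with \<open>i < m\<close> and \<open>j < n\<close>, listed with index \<open>i * n + j\<close>\<close>
  define v where "v = (\<lambda>k. x ^ (k div n) * y ^ (k mod n))"
  have m: "m > 0"
    using p by (cases "m = 0") (auto simp: m_def elim!: degree_eq_zeroE)
  have n: "n > 0"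
    using q by (cases "n = 0") (auto simp: n_def elim!: degree_eq_zeroE)
  have small: "x ^ i * y ^ j \<in> lin_combs A {..<m * n} v" if "i < m" "j < n" for i j
  proof -
    have "i * n + j < m * n"
    proof -
      have "i * n + j < (i + 1) * n" using that by simp
      also have "\<dots> \<le> m * n" using that by (intro mult_right_mono) auto
      finally show ?thesis .
    qed
    moreover have "v (i * n + j) = x ^ i * y ^ j" using that by (simp add: v_def)
    ultimately show ?thesis using lin_combs_gen[of "{..<m * n}" "i * n + j" v] by simp
  qed
  have all: "x ^ i * y ^ j \<in> lin_combs A {..<m * n} v" for i j
  proof -
    have "y ^ j * x ^ k \<in> lin_combs A {..<m * n} v" if "k < m" for k
    proof -
      have "x ^ k * y ^ j \<in> lin_combs A {..<m * n} v"
        by (rule lin_combs_mult[OF _ integral_elem_powers_span[OF A q]])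
          (use small that in \<open>simp add: n_def\<close>)
      then show ?thesis by (simp only: mult.commute)
    qed
    then have "y ^ j * x ^ i \<in> lin_combs A {..<m * n} v"
      by (rule lin_combs_mult[OF _ integral_elem_powers_span[OF A p], of "y ^ j" "{..<m * n}" v i])
        (simp add: m_def)
    then show ?thesis by (simp only: mult.commute)
  qed
  show ?thesis
  proof (rule integral_elem_if_stable_span[OF A])
    show "0 < m * n" "v 0 \<noteq> 0" using m n by (auto simp: v_def)
    show "z * v k \<in> lin_combs A {..<m * n} v" for k
    proof -
      have "z * v k = z * (x ^ (k div n) * y ^ (k mod n))" by (simp only: v_def)
      then show ?thesis using z[of "k div n" "k mod n"] lin_combs_add[OF all all] all by metis
    qed
  qed
qed

lemma integral_elem_add:
  fixes A :: "'a::field set"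
  assumes "type_subring A" "integral_elem A x" "integral_elem A y"
  shows "integral_elem A (x + y)"
  by (rule integral_elem_if_stable_monomials[OF assms, where f = Suc and g = id and f' = id and g' = Suc])
    (simp add: algebra_simps)

lemma integral_elem_mult:
  fixes A :: "'a::field set"
  assumes "type_subring A" "integral_elem A x" "integral_elem A y"
  shows "integral_elem A (x * y)"
  by (rule integral_elem_if_stable_monomials[OF assms, where f = Suc and g = Suc])
    (simp add: algebra_simps)

lemma (in type_subring) integral_elem_mem:
  assumes "x \<in> A" shows "integral_elem A x"
  unfolding integral_elem_def using assms by (intro bexI[of _ "[:-x, 1:]"]) auto

lemma integral_elems_subring:
  fixes A :: "'a::field set"
  assumes "type_subring A"
  shows "type_subring {x. integral_elem A x}"
proof -
  interpret type_subring A by fact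
  have "integral_elem A (- x)" if "integral_elem A x" for x
    using integral_elem_mult[OF assms integral_elem_mem[OF uminus_in[OF one_in]] that] by simp
  then show ?thesis
    by unfold_locales
      (auto intro: integral_elem_mem integral_elem_mult[OF assms]
        simp: integral_elem_add[OF assms, of _ "- _", simplified])
qed

section \<open>Minimal polynomials over normal domains\<close>

lemma (in type_subring) prod_mset_in: "(\<And>x. x \<in># M \<Longrightarrow> x \<in> A) \<Longrightarrow> prod_mset M \<in> A"
  by (induction M) auto

lemma integral_elem_to_acD:
  assumes "type_subring A" "integral_elem (to_ac ` A) (to_ac x)"
  shows "integral_elem A x"
proof -
  interpret type_subring A by fact
  interpret ac: field_hom to_ac by unfold_locales simp_all
  interpret acp: map_poly_inj_idom_hom to_ac by unfold_locales
  from assms(2) obtain p where p: "p \<in> polys_over (to_ac ` A)" "Polynomial.lead_coeff p = 1" "poly p (to_ac x) = 0"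
    by (auto simp: integral_elem_def)
  define q where "q = map_poly of_ac p"
  have pq: "p = map_poly to_ac q"
    using p(1) by (intro poly_eqI) (auto simp: q_def coeff_map_poly polys_over_def intro!: to_ac_of_ac[symmetric])
  have "q \<in> polys_over A"
    unfolding polys_over_def
  proof (intro CollectI allI)
    fix i
    have "poly.coeff p i \<in> to_ac ` A" using p(1) by (rule polys_over_coeff)
    then show "poly.coeff q i \<in> A" by (auto simp: q_def coeff_map_poly)
  qed
  moreover have "to_ac (Polynomial.lead_coeff q) = to_ac 1"
    using p(2) unfolding pq by simp
  then have "Polynomial.lead_coeff q = 1" by (simp only: to_ac_eq_iff)
  moreover have "to_ac (poly q x) = to_ac 0"
    using p(3) unfolding pq by simp
  then have "poly q x = 0" by (simp only: to_ac_eq_iff)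
  ultimately show ?thesis by (auto simp: integral_elem_def)
qed

text \<open>
  The coefficients of a monic divisor are polynomial expressions in its roots in an algebraic
  closure. These are roots of the given monic polynomial over \<open>A\<close> as well, hence integral.
\<close>

lemma integral_elem_coeff_monic_divisor:
  fixes A :: "'a::field set"
  assumes A: "type_subring A" and g: "g \<in> polys_over A" "Polynomial.lead_coeff g = 1"
    and h: "Polynomial.lead_coeff h = 1" "h dvd g"
  shows "integral_elem A (poly.coeff h i)"
proof -
  interpret type_subring A by fact
  interpret ac: field_hom to_ac by unfold_locales simp_all
  interpret acp: map_poly_inj_idom_hom to_ac by unfold_locales
  define A' where "A' = to_ac ` A"
  have A': "type_subring A'"
  proof
    show "1 \<in> A'" unfolding A'_def to_ac_1[symmetric] by (rule imageI) simp
    show "x - y \<in> A'" "x * y \<in> A'" if "x \<in> A'" "y \<in> A'" for x y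
      using that unfolding A'_def
      by (clarify, metis to_ac_diff imageI diff_in, clarify, metis to_ac_mult imageI mult_in)
  qed
  interpret I: type_subring "{x. integral_elem A' x}"
    by (rule integral_elems_subring[OF A'])
  interpret P: type_subring "polys_over {x. integral_elem A' x}"
    by (rule I.polys_over_subring)
  have "map_poly to_ac h \<noteq> 0" using h(1) by auto
  from alg_closed_imp_factorization[OF this] obtain C where
    C: "map_poly to_ac h = (\<Prod>x\<in>#C. [:- x, 1:])"
    using h(1) by auto
  have "integral_elem A' r" if "r \<in># C" for r
  proof -
    have "poly (map_poly to_ac h) r = 0"
      unfolding C poly_prod_mset using that by (auto simp: prod_mset_zero_iff image_iff)
    then have "poly (map_poly to_ac g) r = 0"
      using h(2) by (auto elim!: dvdE simp: acp.hom_mult)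
    moreover have "map_poly to_ac g \<in> polys_over A'"
      using g(1) by (auto simp: polys_over_def coeff_map_poly A'_def)
    moreover have "Polynomial.lead_coeff (map_poly to_ac g) = 1"
      using g(2) by simp
    ultimately show ?thesis unfolding integral_elem_def by blast
  qed
  then have "map_poly to_ac h \<in> polys_over {x. integral_elem A' x}"
    unfolding C by (intro P.prod_mset_in) (auto intro!: I.uminus_in[simplified] I.one_in[simplified])
  then have "integral_elem A' (to_ac (poly.coeff h i))"
    by (auto simp: polys_over_def)
  then show ?thesis using integral_elem_to_acD[OF A] by (simp add: A'_def)
qed

lemma type_algebra_simps [simp]:
  "carrier ring_of_type_algebra = UNIV"
  "monoid.mult ring_of_type_algebra = (*)"
  "monoid.one ring_of_type_algebra = 1"
  "ring.zero ring_of_type_algebra = 0"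
  "ring.add ring_of_type_algebra = (+)"
  by (auto simp: ring_of_type_algebra_def fun_eq_iff)

lemma a_inv_type_algebra [simp]: "\<ominus>\<^bsub>ring_of_type_algebra\<^esub> x = - (x :: 'a::comm_ring_1)"
proof -
  interpret cring "ring_of_type_algebra :: 'a ring" by (rule cring_from_type_algebra)
  show ?thesis by (rule minus_equality) auto
qed

lemma m_inv_type_algebra:
  assumes "x \<noteq> 0"
  shows "inv\<^bsub>ring_of_type_algebra\<^esub> x = inverse (x :: 'a::field)"
proof -
  interpret Ring.field "ring_of_type_algebra :: 'a ring" by (rule field_from_type_algebra)
  show ?thesis using assms by (intro comm_inv_char) auto
qed

lemma type_subring_if_subring:
  assumes "subring A (ring_of_type_algebra :: 'a::comm_ring_1 ring)"
  shows "type_subring A"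
proof
  show "1 \<in> A" using subringE(3)[OF assms] by simp
  show "x * y \<in> A" if "x \<in> A" "y \<in> A" for x y using subringE(6)[OF assms that] by simp
  show "x - y \<in> A" if "x \<in> A" "y \<in> A" for x y
    using subringE(7)[OF assms that(1) subringE(5)[OF assms that(2)]] by simp
qed

lemma subset_quotient_field:
  fixes A :: "'a::field set"
  assumes "type_subring A"
  shows "A \<subseteq> quotient_field ring_of_type_algebra A"
proof
  interpret type_subring A by fact
  fix y assume "y \<in> A"
  then show "y \<in> quotient_field ring_of_type_algebra A"
    unfolding quotient_field_def using m_inv_type_algebra[of "1::'a"]
    by (intro CollectI exI[of _ y] exI[of _ 1]) simp
qed

text \<open>
  Polynomials of \<^locale>\<open>ring\<close> are coefficient lists with the leading coefficient first. This lemma and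
  the next one translate between them and \<^typ>\<open>'a poly\<close>.
\<close>

lemma Poly_rev_in_polys_over:
  assumes "subring A (ring_of_type_algebra :: 'a::field ring)" "p \<in> carrier (A [X]\<^bsub>ring_of_type_algebra\<^esub>)"
  shows "Poly (rev p) \<in> polys_over A"
    and "p \<noteq> [] \<Longrightarrow> Polynomial.lead_coeff (Poly (rev p)) = Polynomials.lead_coeff p"
    and "Polynomial.degree (Poly (rev p)) = Polynomials.degree p"
proof -
  interpret type_subring A using assms(1) by (rule type_subring_if_subring)
  have p: "set p \<subseteq> A" "p = [] \<or> hd p \<noteq> 0"
    using assms(2) by (auto simp: univ_poly_def polynomial_def)
  show "Poly (rev p) \<in> polys_over A"
    using p(1) by (auto simp: polys_over_def coeff_Poly_eq nth_default_def rev_nth)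
  have deg: "Polynomial.degree (Poly (rev p)) = length p - 1"
  proof (cases "p = []")
    case False
    then have "coeffs (Poly (rev p)) = rev p"
      using p(2) by (cases p) (simp_all add: no_trailing_unfold)
    then show ?thesis
      by (simp add: Polynomial.degree_eq_length_coeffs)
  qed auto
  then show "Polynomial.degree (Poly (rev p)) = Polynomials.degree p" by simp
  show "Polynomial.lead_coeff (Poly (rev p)) = Polynomials.lead_coeff p" if "p \<noteq> []"
    unfolding deg using that by (simp add: coeff_Poly_eq nth_default_def rev_nth hd_conv_nth)
qed

lemma rev_coeffs_in_univ_poly:
  fixes A :: "'a::field set"
  assumes "q \<in> polys_over A"
  shows "rev (coeffs q) \<in> carrier (A [X]\<^bsub>ring_of_type_algebra\<^esub>)"
proof -
  have "set (coeffs q) \<subseteq> A" using assms by (auto simp: coeffs_def polys_over_def)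
  then show ?thesis
    by (cases "q = 0") (auto simp: univ_poly_def polynomial_def hd_rev last_coeffs_eq_coeff_degree)
qed

lemma integral_over_imp_integral_elem:
  fixes A :: "'a::field set"
  assumes "subring A ring_of_type_algebra" "integral_over ring_of_type_algebra A x"
  shows "integral_elem A x"
proof -
  obtain p where p: "p \<in> carrier (A [X]\<^bsub>ring_of_type_algebra\<^esub>)" "p \<noteq> []"
    "Polynomials.lead_coeff p = 1" "ring.eval ring_of_type_algebra p x = 0"
    using assms(2) by (auto simp: integral_over_def)
  then show ?thesis
    using Poly_rev_in_polys_over[OF assms(1) p(1)] poly_Poly_rev[of p x]
    by (auto simp: integral_elem_def intro!: bexI[of _ "Poly (rev p)"])
qed

lemma integral_elem_imp_integral_over:
  fixes A :: "'a::field set"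
  assumes "integral_elem A x"
  shows "integral_over ring_of_type_algebra A x"
proof -
  obtain q where q: "q \<in> polys_over A" "Polynomial.lead_coeff q = 1" "poly q x = 0"
    using assms by (auto simp: integral_elem_def)
  have "q \<noteq> 0" using q(2) by auto
  then show ?thesis
    unfolding integral_over_def
    using rev_coeffs_in_univ_poly[OF q(1)] poly_Poly_rev[of "rev (coeffs q)" x] q
    by (intro bexI[of _ "rev (coeffs q)"]) (auto simp: hd_rev last_coeffs_eq_coeff_degree)
qed

context
  fixes K :: "'a::field set" and x :: 'a
  assumes K: "subfield K ring_of_type_algebra"
    and alg: "(ring.algebraic ring_of_type_algebra over K) x"
begin

interpretation L: Ring.field "ring_of_type_algebra :: 'a ring"
  by (rule field_from_type_algebra)

lemma Irr_nonempty: "L.Irr K x \<noteq> []"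
  using L.IrrE(2)[OF K _ alg] L.pirreducible_degree[OF K L.IrrE(1)[OF K _ alg]] by fastforce

lemma minimal_poly_in_polys_over: "minimal_poly K x \<in> polys_over K"
  unfolding minimal_poly_def
  using Poly_rev_in_polys_over(1)[OF subfieldE(1)[OF K] L.IrrE(1)[OF K _ alg]] by simp

lemma lead_coeff_minimal_poly: "Polynomial.lead_coeff (minimal_poly K x) = 1"
  unfolding minimal_poly_def
  using Poly_rev_in_polys_over(2)[OF subfieldE(1)[OF K] L.IrrE(1)[OF K _ alg] Irr_nonempty]
    L.IrrE(3)[OF K _ alg] by simp

lemma poly_minimal_poly: "poly (minimal_poly K x) x = 0"
  unfolding minimal_poly_def poly_Poly_rev using L.IrrE(4)[OF K _ alg] by simp

lemma degree_minimal_poly_le: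
  assumes "q \<in> polys_over K" "q \<noteq> 0" "poly q x = 0"
  shows "Polynomial.degree (minimal_poly K x) \<le> Polynomial.degree q"
proof -
  have "L.eval (rev (coeffs q)) x = 0"
    using assms(3) poly_Poly_rev[of "rev (coeffs q)" x] by simp
  then have "(L.Irr K x) pdivides\<^bsub>ring_of_type_algebra\<^esub> (rev (coeffs q))"
    using L.Irr_minimal[OF K _ alg rev_coeffs_in_univ_poly[OF assms(1)]] by simp
  then have "Polynomials.degree (L.Irr K x) \<le> Polynomials.degree (rev (coeffs q))"
    using L.pdivides_imp_degree_le[OF subfieldE(1)[OF K] L.IrrE(1)[OF K _ alg] rev_coeffs_in_univ_poly[OF assms(1)]] assms(2)
    by simp
  then show ?thesis
    unfolding minimal_poly_def
    using Poly_rev_in_polys_over(3)[OF subfieldE(1)[OF K] L.IrrE(1)[OF K _ alg]]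
    by (simp add: Polynomial.degree_eq_length_coeffs)
qed

lemma degree_minimal_poly_pos: "Polynomial.degree (minimal_poly K x) > 0"
proof (rule ccontr)
  assume "\<not> ?thesis"
  then obtain c where "minimal_poly K x = [:c:]" by (auto elim: degree_eq_zeroE)
  then show False using poly_minimal_poly lead_coeff_minimal_poly by simp
qed

lemma minimal_poly_dvd:
  assumes "q \<in> polys_over K" "poly q x = 0"
  shows "minimal_poly K x dvd q"
proof -
  interpret type_subring K using type_subring_if_subring[OF subfieldE(1)[OF K]] .
  obtain s r where sr: "r \<in> polys_over K" "q = s * minimal_poly K x + r"
    "Polynomial.degree r < Polynomial.degree (minimal_poly K x)"
    using monic_division_in_polys_over[OF minimal_poly_in_polys_over lead_coeff_minimal_poly
        degree_minimal_poly_pos assms(1)] by blast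
  have "poly r x = 0" using assms(2) poly_minimal_poly by (simp add: sr(2))
  then have "r = 0" using degree_minimal_poly_le[of r] sr by force
  then show ?thesis using sr(2) by simp
qed

end

text \<open>
  The only place where normality enters: the minimal polynomial divides the monic polynomial over
  \<open>A\<close> that witnesses integrality, so its coefficients are integral over \<open>A\<close>, and they lie in the
  quotient field.
\<close>

lemma minimal_poly_in_polys_over_normal:
  fixes A K :: "'a::field set"
  assumes K: "subfield K ring_of_type_algebra"
    and A: "normal_subdomain ring_of_type_algebra A" "quotient_field ring_of_type_algebra A = K"
    and x: "integral_over ring_of_type_algebra A x"
    and alg: "(ring.algebraic ring_of_type_algebra over K) x"
  shows "minimal_poly K x \<in> polys_over A"
proof -
  have subr: "subring A ring_of_type_algebra"
    using A(1) subcringE(1) by (auto simp: normal_subdomain_def subdomain_def subcring_def)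
  interpret type_subring A using type_subring_if_subring[OF subr] .
  have AK: "A \<subseteq> K"
    using subset_quotient_field[OF type_subring_axioms] A(2) by simp
  obtain g where g: "g \<in> polys_over A" "Polynomial.lead_coeff g = 1" "poly g x = 0"
    using integral_over_imp_integral_elem[OF subr x] by (auto simp: integral_elem_def)
  have "minimal_poly K x dvd g"
    using minimal_poly_dvd[OF K alg polys_over_mono[OF AK g(1)] g(3)] .
  then have "integral_elem A (poly.coeff (minimal_poly K x) i)" for i
    by (intro integral_elem_coeff_monic_divisor[OF type_subring_axioms g(1,2)]
        lead_coeff_minimal_poly[OF K alg])
  then have "integral_over ring_of_type_algebra A (poly.coeff (minimal_poly K x) i)" for i
    by (intro integral_elem_imp_integral_over)
  then show ?thesis
    using A minimal_poly_in_polys_over[OF K alg]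
    by (simp add: polys_over_def normal_subdomain_def)
qed

section \<open>Directed unions of principal ideals\<close>

text \<open>
  For generators each of which is a multiple of all later ones, this union of principal ideals is
  already the ideal that they generate; no sums of multiples of different generators occur. The
  ideals \<open>U\<close>, \<open>V\<close> and \<open>UV\<close> of the theorem all have this form.
\<close>

definition directed_ideal :: "'l::field set \<Rightarrow> 's set \<Rightarrow> ('s \<Rightarrow> 'l) \<Rightarrow> 'l set" where
  "directed_ideal B S g = {r * g \<beta> | r \<beta>. r \<in> B \<and> \<beta> \<in> S}"

lemma directed_idealI: "r \<in> B \<Longrightarrow> \<beta> \<in> S \<Longrightarrow> x = r * g \<beta> \<Longrightarrow> x \<in> directed_ideal B S g"
  by (auto simp: directed_ideal_def)

locale directed_generators = type_subring B
  for B :: "'l::field set" +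
  fixes S :: "'s::linorder set" and g :: "'s \<Rightarrow> 'l"
  assumes S_nonempty: "S \<noteq> {}"
    and g_in: "\<alpha> \<in> S \<Longrightarrow> g \<alpha> \<in> B"
    and g_multiple: "\<alpha> \<in> S \<Longrightarrow> \<beta> \<in> S \<Longrightarrow> \<alpha> \<le> \<beta> \<Longrightarrow> \<exists>t\<in>B. g \<alpha> = t * g \<beta>"
begin

lemma directed_idealE:
  assumes "x \<in> directed_ideal B S g" "\<gamma> \<in> S"
  obtains r \<beta> where "r \<in> B" "\<beta> \<in> S" "\<gamma> \<le> \<beta>" "x = r * g \<beta>"
proof -
  obtain r \<alpha> where r: "r \<in> B" "\<alpha> \<in> S" "x = r * g \<alpha>"
    using assms(1) by (auto simp: directed_ideal_def)
  define \<beta> where "\<beta> = max \<alpha> \<gamma>"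
  have \<beta>: "\<beta> \<in> S" "\<alpha> \<le> \<beta>" "\<gamma> \<le> \<beta>" using r(2) assms(2) by (auto simp: \<beta>_def max_def)
  obtain t where "t \<in> B" "g \<alpha> = t * g \<beta>" using g_multiple r(2) \<beta>(1,2) by blast
  then have "r * t \<in> B" "x = (r * t) * g \<beta>" using r by auto
  then show thesis using that \<beta>(1,3) by blast
qed

lemma directed_ideal_subset: "directed_ideal B S g \<subseteq> B"
  using g_in by (auto simp: directed_ideal_def)

lemma zero_in_directed_ideal: "0 \<in> directed_ideal B S g"
  using S_nonempty by (auto simp: directed_ideal_def)

lemma add_in_directed_ideal:
  assumes "x \<in> directed_ideal B S g" "y \<in> directed_ideal B S g"
  shows "x + y \<in> directed_ideal B S g"
proof -
  obtain r \<alpha> where r: "r \<in> B" "\<alpha> \<in> S" "x = r * g \<alpha>"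
    using assms(1) by (auto simp: directed_ideal_def)
  obtain s \<beta> where s: "s \<in> B" "\<beta> \<in> S" "\<alpha> \<le> \<beta>" "y = s * g \<beta>"
    using directed_idealE[OF assms(2) r(2)] .
  obtain t where t: "t \<in> B" "g \<alpha> = t * g \<beta>" using g_multiple r(2) s(2,3) by blast
  show ?thesis
    by (rule directed_idealI[of "r * t + s" _ \<beta>]) (use r s t in \<open>auto simp: algebra_simps\<close>)
qed

lemma mult_in_directed_ideal: "r \<in> B \<Longrightarrow> x \<in> directed_ideal B S g \<Longrightarrow> r * x \<in> directed_ideal B S g"
  by (auto simp: directed_ideal_def) (metis mult.assoc mult_in)

lemma diff_in_directed_ideal:
  assumes "x \<in> directed_ideal B S g" "y \<in> directed_ideal B S g"
  shows "x - y \<in> directed_ideal B S g"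
  using add_in_directed_ideal[OF assms(1) mult_in_directed_ideal[OF uminus_in[OF one_in] assms(2)]]
  by simp

end

section \<open>Monogenic towers\<close>

text \<open>
  The data of the theorem, with \<open>K\<close> any subfield that contains \<open>A\<close>, and \<open>h \<alpha>\<close> described by what makes
  it the minimal polynomial of \<open>b \<alpha>\<close>: it is monic, it vanishes at \<open>b \<alpha>\<close>, and its degree is least over
  \<open>K\<close>. That \<open>h \<alpha>\<close> has coefficients in \<open>A\<close> lets division by \<open>h \<alpha>\<close> stay in \<open>A[X]\<close>.
\<close>

locale monogenic_tower =
  A: type_subring A + B: type_subring B + K: type_subring K
  for A B K :: "'l::field set" +
  fixes S :: "'s::linorder set" and a b :: "'s \<Rightarrow> 'l" and h :: "'s \<Rightarrow> 'l poly"
  assumes AB: "A \<subseteq> B" and AK: "A \<subseteq> K"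
    and inverse_in_K: "x \<in> K \<Longrightarrow> inverse x \<in> K"
    and b_in: "\<alpha> \<in> S \<Longrightarrow> b \<alpha> \<in> B"
    and B_eq: "x \<in> B \<Longrightarrow> \<exists>\<alpha>\<in>S. \<exists>f\<in>polys_over A. x = poly f (b \<alpha>)"
    and a_in: "\<alpha> \<in> S \<Longrightarrow> a \<alpha> \<in> A" and a_nonzero: "\<alpha> \<in> S \<Longrightarrow> a \<alpha> \<noteq> 0"
    and a_quotient: "\<alpha> \<in> S \<Longrightarrow> \<beta> \<in> S \<Longrightarrow> \<alpha> \<le> \<beta> \<Longrightarrow> a \<alpha> / a \<beta> \<in> A"
    and b_affine: "\<alpha> \<in> S \<Longrightarrow> \<beta> \<in> S \<Longrightarrow> \<alpha> \<le> \<beta> \<Longrightarrow> \<exists>c\<in>A. b \<alpha> = a \<alpha> / a \<beta> * b \<beta> + c"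
    and h_in: "\<alpha> \<in> S \<Longrightarrow> h \<alpha> \<in> polys_over A"
    and h_monic: "\<alpha> \<in> S \<Longrightarrow> Polynomial.lead_coeff (h \<alpha>) = 1"
    and h_root: "\<alpha> \<in> S \<Longrightarrow> poly (h \<alpha>) (b \<alpha>) = 0"
    and h_minimal: "\<alpha> \<in> S \<Longrightarrow> q \<in> polys_over K \<Longrightarrow> poly q (b \<alpha>) = 0 \<Longrightarrow> q \<noteq> 0 \<Longrightarrow>
      Polynomial.degree (h \<alpha>) \<le> Polynomial.degree q"
begin

lemma degree_h_pos:
  assumes "\<alpha> \<in> S" shows "Polynomial.degree (h \<alpha>) > 0"
proof (rule ccontr)
  assume "\<not> ?thesis"
  then obtain c where "h \<alpha> = [:c:]" by (auto elim: degree_eq_zeroE)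
  then show False using h_root[OF assms] h_monic[OF assms] by simp
qed

text \<open>
  The classical generator of the different of the monogenic extension \<open>A[b \<alpha>]\<close> of \<open>A\<close>. It annihilates
  \<open>d (b \<alpha>)\<close>, because \<open>d (h \<alpha> (b \<alpha>)) = d 0 = 0\<close>.
\<close>

definition different :: "'s \<Rightarrow> 'l" where
  "different \<alpha> = poly (pderiv (h \<alpha>)) (b \<alpha>)"

lemma different_in: "\<alpha> \<in> S \<Longrightarrow> different \<alpha> \<in> B"
  unfolding different_def
  using pderiv_in_polys_over[OF A.type_subring_axioms h_in] AB b_in polys_over_mono[OF AB]
  by (intro B.poly_in) auto

text \<open>
  Put \<open>e = a \<gamma> / a \<alpha>\<close>, so that \<open>b \<gamma> = e * b \<alpha> + c\<close>. Substituting this, or its inverse, turns a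
  polynomial over \<open>K\<close> that vanishes at one of the two elements into one of the same degree that
  vanishes at the other. Hence both minimal polynomials have the same degree \<open>m\<close>, and
  \<open>h \<gamma> (e * X + c) = e ^ m * h \<alpha>\<close>, since the difference of the two sides has smaller degree and vanishes
  at \<open>b \<alpha>\<close>. Differentiating and cancelling \<open>e\<close> gives
  \<open>different \<gamma> = e ^ (m - 1) * different \<alpha>\<close>, where \<open>m\<close> is positive and \<open>e\<close> lies in \<open>A\<close>.
\<close>

lemma different_multiple:
  assumes "\<gamma> \<in> S" "\<alpha> \<in> S" "\<gamma> \<le> \<alpha>"
  shows "\<exists>t\<in>B. different \<gamma> = t * different \<alpha>"
proof -
  define e where "e = a \<gamma> / a \<alpha>"
  have e: "e \<in> A" "e \<noteq> 0"
    using a_quotient[OF assms] a_nonzero assms by (auto simp: e_def)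
  obtain c where c: "c \<in> A" "b \<gamma> = e * b \<alpha> + c"
    using b_affine[OF assms] by (auto simp: e_def)
  define m where "m = Polynomial.degree (h \<gamma>)"
  define p where "p = pcompose (h \<gamma>) [:c, e:]"
  define p' where "p' = pcompose (h \<alpha>) [:- (c * inverse e), inverse e:]"
  have p_in: "p \<in> polys_over A"
    unfolding p_def using h_in[OF assms(1)] c(1) e(1) by (intro A.pcompose_in_polys_over) auto
  have "inverse e \<in> K" "c \<in> K" using e(1) c(1) AK inverse_in_K by auto
  then have p'_in: "p' \<in> polys_over K"
    unfolding p'_def using polys_over_mono[OF AK h_in[OF assms(2)]]
    by (intro K.pcompose_in_polys_over) auto
  have deg_p: "Polynomial.degree p = m"
    using e(2) by (simp add: p_def m_def)
  have lc_p: "Polynomial.lead_coeff p = e ^ m"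
    unfolding p_def m_def using lead_coeff_comp[of "[:c, e:]" "h \<gamma>"] e(2) h_monic[OF assms(1)]
    by simp
  have deg_p': "Polynomial.degree p' = Polynomial.degree (h \<alpha>)"
    using e(2) by (simp add: p'_def)
  have root: "poly p (b \<alpha>) = 0"
    using h_root[OF assms(1)] c(2) by (simp add: p_def poly_pcompose algebra_simps)
  have "- (c * inverse e) + b \<gamma> * inverse e = b \<alpha>"
    using e(2) by (simp add: c(2) field_simps)
  then have root': "poly p' (b \<gamma>) = 0"
    using h_root[OF assms(2)] by (simp add: p'_def poly_pcompose)
  have nz: "p \<noteq> 0" "p' \<noteq> 0"
    using deg_p deg_p' degree_h_pos assms m_def by fastforce+
  have deg: "Polynomial.degree (h \<alpha>) = m"
    using h_minimal[OF assms(2) polys_over_mono[OF AK p_in] root nz(1)]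
      h_minimal[OF assms(1) p'_in root' nz(2)] deg_p deg_p' by (simp add: m_def)
  have p_eq: "p = Polynomial.smult (e ^ m) (h \<alpha>)"
  proof (rule ccontr)
    define d where "d = p - Polynomial.smult (e ^ m) (h \<alpha>)"
    assume "p \<noteq> Polynomial.smult (e ^ m) (h \<alpha>)"
    then have d: "d \<noteq> 0" by (simp add: d_def)
    have "d \<in> polys_over K"
    proof -
      interpret P: type_subring "polys_over K" by (rule K.polys_over_subring)
      have "Polynomial.smult (e ^ m) (h \<alpha>) \<in> polys_over K"
        using polys_over_mono[OF AK h_in[OF assms(2)]] e(1) AK by (auto simp: polys_over_def)
      then show ?thesis using polys_over_mono[OF AK p_in] by (auto simp: d_def)
    qed
    moreover have "poly d (b \<alpha>) = 0" using root h_root[OF assms(2)] by (simp add: d_def)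
    ultimately have "m \<le> Polynomial.degree d"
      using h_minimal[OF assms(2)] d deg by simp
    moreover have "Polynomial.degree d \<le> m"
      unfolding d_def using deg deg_p e(2) by (intro degree_diff_le) auto
    moreover have "poly.coeff d m = 0"
      using deg deg_p lc_p h_monic[OF assms(2)] by (simp add: d_def)
    ultimately show False using d by (metis le_antisym leading_coeff_0_iff)
  qed
  have "e * different \<gamma> = poly (pderiv p) (b \<alpha>)"
    by (simp add: p_def pderiv_pcompose poly_pcompose different_def c(2) pderiv_pCons algebra_simps)
  also have "\<dots> = e ^ m * different \<alpha>"
    by (simp add: p_eq pderiv_smult different_def)
  also have "\<dots> = e * (e ^ (m - 1) * different \<alpha>)"
    using degree_h_pos[OF assms(1)] by (cases m) (auto simp: m_def)
  finally have "different \<gamma> = e ^ (m - 1) * different \<alpha>" using e(2) by simp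
  then show ?thesis using e(1) AB by auto
qed

lemma S_nonempty: "S \<noteq> {}"
  using B_eq[OF B.one_in] by auto

lemma a_multiple: "\<alpha> \<in> S \<Longrightarrow> \<beta> \<in> S \<Longrightarrow> \<alpha> \<le> \<beta> \<Longrightarrow> \<exists>t\<in>B. a \<alpha> = t * a \<beta>"
  using a_quotient a_nonzero AB by (intro bexI[of _ "a \<alpha> / a \<beta>"]) auto

sublocale U: directed_generators B S a
  using S_nonempty a_in AB a_multiple by unfold_locales auto

sublocale V: directed_generators B S different
  using S_nonempty different_in different_multiple by unfold_locales auto

sublocale W: directed_generators B S "\<lambda>\<alpha>. a \<alpha> * different \<alpha>"
proof
  show "\<exists>t\<in>B. a \<alpha> * different \<alpha> = t * (a \<beta> * different \<beta>)"
    if "\<alpha> \<in> S" "\<beta> \<in> S" "\<alpha> \<le> \<beta>" for \<alpha> \<beta>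
  proof -
    obtain t where "t \<in> B" "a \<alpha> = t * a \<beta>" using a_multiple \<open>\<alpha> \<in> S\<close> \<open>\<beta> \<in> S\<close> \<open>\<alpha> \<le> \<beta>\<close> by blast
    moreover obtain u where "u \<in> B" "different \<alpha> = u * different \<beta>"
      using different_multiple \<open>\<alpha> \<in> S\<close> \<open>\<beta> \<in> S\<close> \<open>\<alpha> \<le> \<beta>\<close> by blast
    ultimately show ?thesis by (intro bexI[of _ "t * u"]) auto
  qed
qed (use S_nonempty a_in AB different_in in auto)

abbreviation (input) U where "U \<equiv> directed_ideal B S a"
abbreviation (input) V where "V \<equiv> directed_ideal B S different"
text \<open>
  \<open>W\<close> is the product ideal \<open>UV\<close>: a multiple of \<open>a \<alpha>\<close> and a multiple of \<open>different \<beta>\<close> are multiples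
  of the two generators at the larger of the indices \<open>\<alpha>\<close>, \<open>\<beta>\<close>.
\<close>

abbreviation (input) W where "W \<equiv> directed_ideal B S (\<lambda>\<alpha>. a \<alpha> * different \<alpha>)"

lemma mult_U_V:
  assumes "u \<in> U" "v \<in> V" shows "u * v \<in> W"
proof -
  obtain r \<alpha> where r: "r \<in> B" "\<alpha> \<in> S" "u = r * a \<alpha>"
    using assms(1) by (auto simp: directed_ideal_def)
  obtain s \<beta> where s: "s \<in> B" "\<beta> \<in> S" "\<alpha> \<le> \<beta>" "v = s * different \<beta>"
    using V.directed_idealE[OF assms(2) r(2)] .
  obtain t where t: "t \<in> B" "a \<alpha> = t * a \<beta>" using a_multiple r(2) s(2,3) by blast
  show ?thesis
    by (rule directed_idealI[of "r * t * s" _ \<beta>]) (use r s t in auto)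
qed

text \<open>
  A polynomial over \<open>A\<close> that vanishes at \<open>b \<alpha>\<close> is a multiple \<open>q * h \<alpha>\<close> with \<open>q\<close> over \<open>A\<close>, so its derivative
  there is \<open>q (b \<alpha>)\<close> times the different.
\<close>

lemma pderiv_root_in_W:
  assumes "\<alpha> \<in> S" "f \<in> polys_over A" "poly f (b \<alpha>) = 0"
  shows "poly (pderiv f) (b \<alpha>) * a \<alpha> \<in> W"
proof -
  obtain q r where qr: "q \<in> polys_over A" "r \<in> polys_over A" "f = q * h \<alpha> + r"
    "Polynomial.degree r < Polynomial.degree (h \<alpha>)"
    using A.monic_division_in_polys_over[OF h_in h_monic degree_h_pos assms(2)] assms(1) by blast
  have "poly r (b \<alpha>) = 0" using assms(3) h_root[OF assms(1)] by (simp add: qr(3))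
  then have "r = 0"
    using h_minimal[OF assms(1) polys_over_mono[OF AK qr(2)]] qr(4) by force
  then have eq: "poly (pderiv f) (b \<alpha>) * a \<alpha> = poly q (b \<alpha>) * (a \<alpha> * different \<alpha>)"
    using h_root[OF assms(1)] by (simp add: qr(3) pderiv_mult different_def)
  have "poly q (b \<alpha>) \<in> B"
    using b_in assms(1) polys_over_mono[OF AB qr(1)] by (intro B.poly_in)
  then show ?thesis using assms(1) eq by (rule directed_idealI)
qed

text \<open>
  Passing from \<open>b \<alpha>\<close> to \<open>b \<beta>\<close> multiplies derivatives by \<open>a \<alpha> / a \<beta>\<close>. The factor \<open>a \<alpha>\<close> in the value
  \<open>f'(b \<alpha>) * a \<alpha>\<close> compensates for this.
\<close>

lemma raise_index:
  assumes "\<alpha> \<in> S" "\<beta> \<in> S" "\<alpha> \<le> \<beta>" "f \<in> polys_over A"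
  obtains g where "g \<in> polys_over A" "poly g (b \<beta>) = poly f (b \<alpha>)"
    "poly (pderiv g) (b \<beta>) * a \<beta> = poly (pderiv f) (b \<alpha>) * a \<alpha>"
proof -
  obtain c where c: "c \<in> A" "b \<alpha> = a \<alpha> / a \<beta> * b \<beta> + c" using b_affine[OF assms(1-3)] by blast
  define g where "g = pcompose f [:c, a \<alpha> / a \<beta>:]"
  show thesis
  proof (rule that[of g])
    show "g \<in> polys_over A"
      unfolding g_def using assms(4) c(1) a_quotient[OF assms(1-3)]
      by (intro A.pcompose_in_polys_over) auto
    show "poly g (b \<beta>) = poly f (b \<alpha>)" by (simp add: g_def poly_pcompose c(2) algebra_simps)
    show "poly (pderiv g) (b \<beta>) * a \<beta> = poly (pderiv f) (b \<alpha>) * a \<alpha>"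
      using a_nonzero[OF assms(2)]
      by (simp add: g_def poly_pcompose pderiv_pcompose pderiv_pCons c(2) algebra_simps)
  qed
qed

lemma deriv_value_unique:
  assumes "\<alpha> \<in> S" "\<beta> \<in> S" "f \<in> polys_over A" "g \<in> polys_over A" "poly f (b \<alpha>) = poly g (b \<beta>)"
  shows "poly (pderiv f) (b \<alpha>) * a \<alpha> - poly (pderiv g) (b \<beta>) * a \<beta> \<in> W"
proof -
  interpret P: type_subring "polys_over A" by (rule A.polys_over_subring)
  define \<gamma> where "\<gamma> = max \<alpha> \<beta>"
  have \<gamma>: "\<gamma> \<in> S" "\<alpha> \<le> \<gamma>" "\<beta> \<le> \<gamma>" using assms(1,2) by (auto simp: \<gamma>_def max_def)
  obtain f' where f': "f' \<in> polys_over A" "poly f' (b \<gamma>) = poly f (b \<alpha>)"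
    "poly (pderiv f') (b \<gamma>) * a \<gamma> = poly (pderiv f) (b \<alpha>) * a \<alpha>"
    using raise_index[OF assms(1) \<gamma>(1,2) assms(3)] .
  obtain g' where g': "g' \<in> polys_over A" "poly g' (b \<gamma>) = poly g (b \<beta>)"
    "poly (pderiv g') (b \<gamma>) * a \<gamma> = poly (pderiv g) (b \<beta>) * a \<beta>"
    using raise_index[OF assms(2) \<gamma>(1,3) assms(4)] .
  show ?thesis
    using pderiv_root_in_W[OF \<gamma>(1) P.diff_in[OF f'(1) g'(1)]] f' g' assms(5)
    by (simp add: pderiv_diff left_diff_distrib)
qed

text \<open>
  Representatives for the derivation \<open>f(b \<alpha>) \<mapsto> f'(b \<alpha>) * a \<alpha>\<close> from \<open>B\<close> to \<open>U / W\<close>. The value is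
  determined by \<open>x\<close> only modulo \<open>W\<close>. Choosing an element of \<open>U\<close> makes it possible to extend linearly
  with plain sums in the field, and all laws below hold modulo \<open>W\<close>.
\<close>

definition deriv_lift :: "'l \<Rightarrow> 'l" where
  "deriv_lift x = (SOME y. \<exists>\<alpha>\<in>S. \<exists>f\<in>polys_over A.
     poly f (b \<alpha>) = x \<and> y = poly (pderiv f) (b \<alpha>) * a \<alpha>)"

lemma deriv_lift_repr:
  assumes "x \<in> B"
  obtains \<alpha> f where "\<alpha> \<in> S" "f \<in> polys_over A" "poly f (b \<alpha>) = x"
    "deriv_lift x = poly (pderiv f) (b \<alpha>) * a \<alpha>"
proof -
  have "\<exists>y. \<exists>\<alpha>\<in>S. \<exists>f\<in>polys_over A. poly f (b \<alpha>) = x \<and> y = poly (pderiv f) (b \<alpha>) * a \<alpha>"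
    using B_eq[OF assms] by blast
  from someI_ex[OF this, folded deriv_lift_def] show thesis using that by blast
qed

lemma poly_b_in:
  assumes "\<alpha> \<in> S" "f \<in> polys_over A" shows "poly f (b \<alpha>) \<in> B"
  using b_in assms(1) polys_over_mono[OF AB assms(2)] by (intro B.poly_in)

lemma deriv_lift_poly:
  assumes "\<alpha> \<in> S" "f \<in> polys_over A"
  shows "deriv_lift (poly f (b \<alpha>)) - poly (pderiv f) (b \<alpha>) * a \<alpha> \<in> W"
proof -
  obtain \<beta> g where "\<beta> \<in> S" "g \<in> polys_over A" "poly g (b \<beta>) = poly f (b \<alpha>)"
    "deriv_lift (poly f (b \<alpha>)) = poly (pderiv g) (b \<beta>) * a \<beta>"
    using deriv_lift_repr[OF poly_b_in[OF assms]] .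
  then show ?thesis using deriv_value_unique[of \<beta> \<alpha> g f] assms by simp
qed

lemma deriv_lift_in_U:
  assumes "x \<in> B" shows "deriv_lift x \<in> U"
proof -
  obtain \<alpha> f where "\<alpha> \<in> S" "f \<in> polys_over A" "deriv_lift x = poly (pderiv f) (b \<alpha>) * a \<alpha>"
    using deriv_lift_repr[OF assms] by blast
  then show ?thesis
    using poly_b_in[OF _ pderiv_in_polys_over[OF A.type_subring_axioms]] by (intro directed_idealI)
qed

lemma common_index:
  assumes "x \<in> B" "y \<in> B"
  obtains \<alpha> f g where "\<alpha> \<in> S" "f \<in> polys_over A" "g \<in> polys_over A" "x = poly f (b \<alpha>)" "y = poly g (b \<alpha>)"
proof -
  obtain \<alpha> f where f: "\<alpha> \<in> S" "f \<in> polys_over A" "x = poly f (b \<alpha>)" using B_eq[OF assms(1)] by blast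
  obtain \<beta> g where g: "\<beta> \<in> S" "g \<in> polys_over A" "y = poly g (b \<beta>)" using B_eq[OF assms(2)] by blast
  define \<gamma> where "\<gamma> = max \<alpha> \<beta>"
  have \<gamma>: "\<gamma> \<in> S" "\<alpha> \<le> \<gamma>" "\<beta> \<le> \<gamma>" using f(1) g(1) by (auto simp: \<gamma>_def max_def)
  show thesis
    using raise_index[OF f(1) \<gamma>(1,2) f(2)] raise_index[OF g(1) \<gamma>(1,3) g(2)] that[OF \<gamma>(1)] f(3) g(3)
    by metis
qed

lemma deriv_lift_add:
  assumes "x \<in> B" "y \<in> B"
  shows "deriv_lift (x + y) - (deriv_lift x + deriv_lift y) \<in> W"
proof -
  interpret P: type_subring "polys_over A" by (rule A.polys_over_subring)
  obtain \<alpha> f g where fg: "\<alpha> \<in> S" "f \<in> polys_over A" "g \<in> polys_over A" "x = poly f (b \<alpha>)" "y = poly g (b \<alpha>)"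
    using common_index[OF assms] .
  let ?D = "\<lambda>f. deriv_lift (poly f (b \<alpha>)) - poly (pderiv f) (b \<alpha>) * a \<alpha>"
  have "?D (f + g) - ?D f - ?D g \<in> W"
    by (rule W.diff_in_directed_ideal[OF W.diff_in_directed_ideal[OF deriv_lift_poly deriv_lift_poly]
          deriv_lift_poly])
      (rule fg(1-3) P.add_in)+
  moreover have "?D (f + g) - ?D f - ?D g = deriv_lift (x + y) - (deriv_lift x + deriv_lift y)"
    by (simp add: fg pderiv_add algebra_simps)
  ultimately show ?thesis by simp
qed

lemma deriv_lift_mult:
  assumes "x \<in> B" "y \<in> B"
  shows "deriv_lift (x * y) - (x * deriv_lift y + y * deriv_lift x) \<in> W"
proof -
  interpret P: type_subring "polys_over A" by (rule A.polys_over_subring)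
  obtain \<alpha> f g where fg: "\<alpha> \<in> S" "f \<in> polys_over A" "g \<in> polys_over A" "x = poly f (b \<alpha>)" "y = poly g (b \<alpha>)"
    using common_index[OF assms] .
  let ?D = "\<lambda>f. deriv_lift (poly f (b \<alpha>)) - poly (pderiv f) (b \<alpha>) * a \<alpha>"
  have "?D (f * g) - x * ?D g - y * ?D f \<in> W"
    by (rule W.diff_in_directed_ideal[OF W.diff_in_directed_ideal[OF deriv_lift_poly
            W.mult_in_directed_ideal[OF assms(1) deriv_lift_poly]]
          W.mult_in_directed_ideal[OF assms(2) deriv_lift_poly]])
      (rule fg(1-3) P.mult_in)+
  moreover have "?D (f * g) - x * ?D g - y * ?D f
      = deriv_lift (x * y) - (x * deriv_lift y + y * deriv_lift x)"
    by (simp add: fg pderiv_mult algebra_simps)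
  ultimately show ?thesis by simp
qed

lemma deriv_lift_const:
  assumes "x \<in> A" shows "deriv_lift x \<in> W"
proof -
  obtain \<alpha> where "\<alpha> \<in> S" using S_nonempty by auto
  then show ?thesis using deriv_lift_poly[of \<alpha> "[:x:]"] assms by simp
qed

lemma deriv_lift_b:
  assumes "\<alpha> \<in> S" shows "deriv_lift (b \<alpha>) - a \<alpha> \<in> W"
  using deriv_lift_poly[of \<alpha> "[:0, 1:]"] assms by (simp add: pderiv_pCons)

end

section \<open>Isomorphisms of quotient modules\<close>

lemma quot_module_smult_coset:
  assumes "Module.module R M" "submodule N R M" "r \<in> carrier R" "x \<in> carrier M"
  shows "r \<odot>\<^bsub>quot_module M N\<^esub> (N +>\<^bsub>M\<^esub> x) = N +>\<^bsub>M\<^esub> (r \<odot>\<^bsub>M\<^esub> x)"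
proof -
  interpret Module.module R M by fact
  interpret S: submodule N R M by fact
  have asub: "additive_subgroup N M" by (rule additive_subgroup.intro[OF S.subgroup_axioms])
  interpret asg: abelian_subgroup N M
    by (rule abelian_subgroupI3[OF asub M.abelian_group_axioms])
  have N: "N \<subseteq> carrier M" using S.subset by simp
  have "N +>\<^bsub>M\<^esub> (r \<odot>\<^bsub>M\<^esub> z) = N +>\<^bsub>M\<^esub> (r \<odot>\<^bsub>M\<^esub> x)" if "z \<in> N +>\<^bsub>M\<^esub> x" for z
  proof -
    obtain k where k: "k \<in> N" "z = k \<oplus>\<^bsub>M\<^esub> x" using \<open>z \<in> _\<close> by (auto simp: a_r_coset_def')
    have "r \<odot>\<^bsub>M\<^esub> z = r \<odot>\<^bsub>M\<^esub> k \<oplus>\<^bsub>M\<^esub> r \<odot>\<^bsub>M\<^esub> x" using k assms(3,4) N by (auto simp: smult_r_distr)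
    then have "r \<odot>\<^bsub>M\<^esub> z \<in> N +>\<^bsub>M\<^esub> (r \<odot>\<^bsub>M\<^esub> x)" using k assms(3) by (auto simp: a_r_coset_def')
    then show ?thesis using M.a_repr_independence[OF _ _ S.subgroup_axioms] assms(3,4) by simp
  qed
  moreover have "x \<in> N +>\<^bsub>M\<^esub> x" using assms(4) by (rule asg.a_rcos_self)
  ultimately have "(\<Union>z\<in>N +>\<^bsub>M\<^esub> x. N +>\<^bsub>M\<^esub> (r \<odot>\<^bsub>M\<^esub> z)) = N +>\<^bsub>M\<^esub> (r \<odot>\<^bsub>M\<^esub> x)"
    by (intro SUP_eq_const) blast+
  then show ?thesis by (simp add: quot_module_def)
qed

text \<open>
  The first isomorphism theorem for \<open>x \<mapsto> N' + \<phi> x\<close>, whose kernel is \<open>N\<close>. The group part comes from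
  \<open>FactGroup_iso_set\<close>; what remains is compatibility with scalars, which is checked on cosets.
\<close>

lemma module_isomorphic_quot_module:
  assumes M: "Module.module R M" and M': "Module.module R M'" and N': "submodule N' R M'"
    and cl: "\<And>x. x \<in> carrier M \<Longrightarrow> \<phi> x \<in> carrier M'"
    and add: "\<And>x y. x \<in> carrier M \<Longrightarrow> y \<in> carrier M \<Longrightarrow> \<phi> (x \<oplus>\<^bsub>M\<^esub> y) = \<phi> x \<oplus>\<^bsub>M'\<^esub> \<phi> y"
    and smult: "\<And>r x. r \<in> carrier R \<Longrightarrow> x \<in> carrier M \<Longrightarrow> \<phi> (r \<odot>\<^bsub>M\<^esub> x) = r \<odot>\<^bsub>M'\<^esub> \<phi> x"
    and onto: "\<And>y. y \<in> carrier M' \<Longrightarrow> \<exists>x\<in>carrier M. y \<in> N' +>\<^bsub>M'\<^esub> \<phi> x"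
    and N: "submodule N R M" "\<And>x. x \<in> carrier M \<Longrightarrow> x \<in> N \<longleftrightarrow> \<phi> x \<in> N'"
  shows "module_isomorphic R (quot_module M N) (quot_module M' N')"
proof -
  interpret M: Module.module R M by fact
  interpret M': Module.module R M' by fact
  interpret S: submodule N R M by fact
  interpret S': submodule N' R M' by fact
  interpret Q': Module.module R "quot_module M' N'" by (rule quot_module_is_module[OF M' N'])
  have asub': "additive_subgroup N' M'" by (rule additive_subgroup.intro[OF S'.subgroup_axioms])
  interpret asg': abelian_subgroup N' M'
    by (rule abelian_subgroupI3[OF asub' M'.abelian_group_axioms])
  have asub: "additive_subgroup N M" by (rule additive_subgroup.intro[OF S.subgroup_axioms])
  interpret asg: abelian_subgroup N M
    by (rule abelian_subgroupI3[OF asub M.abelian_group_axioms])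
  define G where "G = add_monoid M"
  define H where "H = add_monoid (quot_module M' N')"
  define \<psi> where "\<psi> x = N' +>\<^bsub>M'\<^esub> \<phi> x" for x
  have carrH: "carrier H = (\<lambda>y. N' +>\<^bsub>M'\<^esub> y) ` carrier M'"
    by (auto simp: H_def quot_module_def A_RCOSETS_def')
  have oneH: "one H = N'" by (simp add: H_def quot_module_def)
  have hom: "\<psi> \<in> hom G H"
    by (rule homI) (auto simp: carrH \<psi>_def G_def cl add asg'.a_rcos_sum H_def quot_module_def A_RCOSETS_def'
        intro!: arg_cong[of _ _ "\<lambda>y. N' +>\<^bsub>M'\<^esub> y"])
  interpret \<psi>: group_hom G H \<psi>
    using hom M.a_group Q'.a_group by (auto intro!: group_hom.intro group_hom_axioms.intro simp: G_def H_def)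
  have "\<psi> x = N' \<longleftrightarrow> \<phi> x \<in> N'" if "x \<in> carrier M" for x
    using cl[OF that] asg'.a_rcos_self[of "\<phi> x"] asg'.a_rcos_const[of "\<phi> x"] by (auto simp: \<psi>_def)
  then have kernel: "kernel G H \<psi> = N"
    using N(2) S.subset unfolding kernel_def oneH by (auto simp: G_def)
  have surj: "\<psi> ` carrier G = carrier H"
  proof (intro equalityI subsetI)
    fix C assume "C \<in> carrier H"
    then obtain y where y: "y \<in> carrier M'" "C = N' +>\<^bsub>M'\<^esub> y" by (auto simp: carrH)
    then obtain x where x: "x \<in> carrier M" "y \<in> N' +>\<^bsub>M'\<^esub> \<phi> x" using onto by blast
    then have "C = \<psi> x"
      using M'.a_repr_independence[OF x(2) cl[OF x(1)] S'.subgroup_axioms] y(2) by (simp add: \<psi>_def)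
    then show "C \<in> \<psi> ` carrier G" using x(1) by (simp add: G_def)
  qed (use \<psi>.hom_closed in auto)
  have FG: "iso (G Mod N) H = iso (add_monoid (quot_module M N)) H"
    by (simp add: iso_def hom_def FactGroup_def G_def quot_module_def A_RCOSETS_def set_add_def)
  define F where "F = (\<lambda>C. the_elem (\<psi> ` C))"
  have "F \<in> iso (add_monoid (quot_module M N)) H"
    using \<psi>.FactGroup_iso_set[OF surj] unfolding kernel FG F_def .
  moreover have F_coset: "F (N +>\<^bsub>M\<^esub> x) = \<psi> x" if x: "x \<in> carrier M" for x
  proof -
    have "\<psi> z = \<psi> x" if "z \<in> N +>\<^bsub>M\<^esub> x" for z
    proof -
      obtain k where k: "k \<in> N" "z = k \<oplus>\<^bsub>M\<^esub> x" using \<open>z \<in> _\<close> by (auto simp: a_r_coset_def')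
      have kM: "k \<in> carrier M" using k(1) S.subset by auto
      have "\<phi> z \<in> N' +>\<^bsub>M'\<^esub> \<phi> x"
        using k x kM N(2)[OF kM] by (auto simp: add a_r_coset_def')
      then show ?thesis
        using M'.a_repr_independence[OF _ cl[OF x] S'.subgroup_axioms] by (simp add: \<psi>_def)
    qed
    moreover have "x \<in> N +>\<^bsub>M\<^esub> x" using x by (rule asg.a_rcos_self)
    ultimately have "\<psi> ` (N +>\<^bsub>M\<^esub> x) = {\<psi> x}" by blast
    then show ?thesis by (simp add: F_def)
  qed
  have "F (r \<odot>\<^bsub>quot_module M N\<^esub> C) = r \<odot>\<^bsub>quot_module M' N'\<^esub> F C"
    if "r \<in> carrier R" "C \<in> carrier (quot_module M N)" for r C
  proof -
    obtain x where x: "x \<in> carrier M" "C = N +>\<^bsub>M\<^esub> x"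
      using \<open>C \<in> _\<close> by (auto simp: quot_module_def A_RCOSETS_def')
    show ?thesis
      using that(1) x cl[OF x(1)]
      by (simp add: quot_module_smult_coset[OF M N(1)] quot_module_smult_coset[OF M' N'] F_coset \<psi>_def smult)
  qed
  ultimately show ?thesis unfolding module_isomorphic_def H_def by blast
qed

section \<open>Differentials modulo their relations\<close>

context monogenic_tower
begin

text \<open>
  The generator \<open>d x\<close> of the free module on \<open>B\<close>. The same function as \<^const>\<open>free_gen\<close> for the ring \<open>B\<close>,
  written with the operations of the type so that elements of the free module can be computed with
  pointwise.
\<close>

definition dgen :: "'l \<Rightarrow> 'l \<Rightarrow> 'l" where
  "dgen x = (\<lambda>i. if i = x then 1 else 0)"

text \<open>
  The linear extension of \<open>d x \<mapsto> deriv_lift x\<close> to finitely supported functions.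
\<close>

definition evaluate :: "('l \<Rightarrow> 'l) \<Rightarrow> 'l" where
  "evaluate g = (\<Sum>x | g x \<noteq> 0. g x * deriv_lift x)"

lemma evaluate_superset:
  assumes "finite T" "{x. g x \<noteq> 0} \<subseteq> T"
  shows "evaluate g = (\<Sum>x\<in>T. g x * deriv_lift x)"
  unfolding evaluate_def by (rule sum.mono_neutral_left) (use assms in auto)

lemma evaluate_add:
  assumes "finite {x. f x \<noteq> 0}" "finite {x. g x \<noteq> 0}"
  shows "evaluate (\<lambda>i. f i + g i) = evaluate f + evaluate g"
proof -
  let ?T = "{x. f x \<noteq> 0} \<union> {x. g x \<noteq> 0}"
  have "evaluate (\<lambda>i. f i + g i) = (\<Sum>x\<in>?T. (f x + g x) * deriv_lift x)"
    by (rule evaluate_superset) (use assms in auto)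
  also have "\<dots> = (\<Sum>x\<in>?T. f x * deriv_lift x) + (\<Sum>x\<in>?T. g x * deriv_lift x)"
    by (simp add: distrib_right sum.distrib)
  also have "(\<Sum>x\<in>?T. f x * deriv_lift x) = evaluate f"
    by (rule evaluate_superset[symmetric]) (use assms in auto)
  also have "(\<Sum>x\<in>?T. g x * deriv_lift x) = evaluate g"
    by (rule evaluate_superset[symmetric]) (use assms in auto)
  finally show ?thesis .
qed

lemma evaluate_scale:
  assumes "finite {x. f x \<noteq> 0}"
  shows "evaluate (\<lambda>i. r * f i) = r * evaluate f"
  using assms evaluate_superset[of "{x. f x \<noteq> 0}"]
  by (auto simp: sum_distrib_left mult.assoc subset_iff)

lemma evaluate_diff:
  assumes "finite {x. f x \<noteq> 0}" "finite {x. g x \<noteq> 0}"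
  shows "evaluate (\<lambda>i. f i - g i) = evaluate f - evaluate g"
  using evaluate_add[of f "\<lambda>i. -1 * g i"] evaluate_scale[of g "-1"] assms by simp

lemma finite_dgen [simp]: "finite {i. dgen x i \<noteq> 0}"
  by (simp add: dgen_def)

lemma evaluate_dgen: "evaluate (dgen x) = deriv_lift x"
  by (simp add: evaluate_def dgen_def)

lemma evaluate_in_U:
  assumes "\<And>i. g i \<in> B" "\<And>i. i \<notin> B \<Longrightarrow> g i = 0"
  shows "evaluate g \<in> U"
proof -
  have "(\<Sum>x\<in>T. g x * deriv_lift x) \<in> U" if "T \<subseteq> B" for T
    using that
    by (induction T rule: infinite_finite_induct)
      (simp_all add: U.zero_in_directed_ideal U.add_in_directed_ideal U.mult_in_directed_ideal
        deriv_lift_in_U assms(1))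
  moreover have "{x. g x \<noteq> 0} \<subseteq> B" using assms(2) by blast
  ultimately show ?thesis unfolding evaluate_def by simp
qed

end

text \<open>
  A set \<open>N\<close> of functions that contains the relations between differentials and is closed under linear
  combinations over \<open>B\<close>. Congruence of \<open>f\<close> and \<open>g\<close> in the module of differentials is expressed by
  \<open>(\<lambda>i. f i - g i) \<in> N\<close>.
\<close>

locale differential_relations = monogenic_tower +
  fixes N :: "('a \<Rightarrow> 'a) set"
  assumes N_zero: "(\<lambda>_. 0) \<in> N"
    and N_add: "f \<in> N \<Longrightarrow> g \<in> N \<Longrightarrow> (\<lambda>i. f i + g i) \<in> N"
    and N_scale: "r \<in> B \<Longrightarrow> f \<in> N \<Longrightarrow> (\<lambda>i. r * f i) \<in> N"
    and N_dgen_add: "x \<in> B \<Longrightarrow> y \<in> B \<Longrightarrow> (\<lambda>i. dgen (x + y) i - (dgen x i + dgen y i)) \<in> N"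
    and N_dgen_mult: "x \<in> B \<Longrightarrow> y \<in> B \<Longrightarrow> (\<lambda>i. dgen (x * y) i - (x * dgen y i + y * dgen x i)) \<in> N"
    and N_dgen_const: "x \<in> A \<Longrightarrow> dgen x \<in> N"
begin

lemma N_diff: "f \<in> N \<Longrightarrow> g \<in> N \<Longrightarrow> (\<lambda>i. f i - g i) \<in> N"
  using N_add[of f "\<lambda>i. -1 * g i"] N_scale[of "-1" g] by auto

lemma dgen_poly:
  assumes "f \<in> polys_over A" "x \<in> B"
  shows "(\<lambda>i. dgen (poly f x) i - poly (pderiv f) x * dgen x i) \<in> N"
  using assms(1)
proof (induction f)
  case 0
  then show ?case using N_dgen_const[of 0] by simp
next
  case (pCons c f)
  have f: "f \<in> polys_over A" "c \<in> A" using pCons.prems by auto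
  have fx: "poly f x \<in> B" "c \<in> B"
    using polys_over_mono[OF AB f(1)] assms(2) f(2) AB by (auto intro: B.poly_in)
  have "(\<lambda>i. (dgen (c + x * poly f x) i - (dgen c i + dgen (x * poly f x) i)) + dgen c i
      + (dgen (x * poly f x) i - (x * dgen (poly f x) i + poly f x * dgen x i))
      + x * (dgen (poly f x) i - poly (pderiv f) x * dgen x i)) \<in> N"
    using pCons.IH[OF f(1)] fx f assms(2)
    by (intro N_add N_scale N_dgen_add N_dgen_mult N_dgen_const) auto
  then show ?case by (simp add: pderiv_pCons algebra_simps)
qed

text \<open>
  The relations \<open>d (b \<alpha>) = (a \<alpha> / a \<beta>) * d (b \<beta>)\<close> have the same coefficients as the relations
  \<open>a \<alpha> = (a \<alpha> / a \<beta>) * a \<beta>\<close> between the generators of \<open>U\<close>.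
\<close>

lemma dgen_b:
  assumes "\<alpha> \<in> S" "\<beta> \<in> S" "\<alpha> \<le> \<beta>"
  shows "(\<lambda>i. dgen (b \<alpha>) i - a \<alpha> / a \<beta> * dgen (b \<beta>) i) \<in> N"
proof -
  obtain c where c: "c \<in> A" "b \<alpha> = a \<alpha> / a \<beta> * b \<beta> + c" using b_affine[OF assms] by blast
  show ?thesis
    using dgen_poly[of "[:c, a \<alpha> / a \<beta>:]" "b \<beta>"] c(1) a_quotient[OF assms] b_in[OF assms(2)]
    by (simp add: pderiv_pCons c(2) algebra_simps)
qed

lemma raise_dgen_b:
  assumes "\<alpha> \<in> S" "\<beta> \<in> S" "\<alpha> \<le> \<beta>" "r \<in> B" "(\<lambda>i. g i - r * dgen (b \<alpha>) i) \<in> N"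
  shows "(\<lambda>i. g i - r * (a \<alpha> / a \<beta>) * dgen (b \<beta>) i) \<in> N"
  using N_add[OF assms(5) N_scale[OF assms(4) dgen_b[OF assms(1-3)]]]
  by (simp add: algebra_simps)

text \<open>
  Every \<open>d x\<close> is a multiple of some \<open>d (b \<alpha>)\<close>, and finitely many of these are multiples of a single
  \<open>d (b \<beta>)\<close> with \<open>\<beta>\<close> above all indices that occur.
\<close>

lemma reduce_to_dgen_b:
  assumes "finite T" "T \<subseteq> B" "\<And>x. g x \<in> B"
  shows "\<exists>\<beta>\<in>S. \<exists>r\<in>B. (\<lambda>i. (\<Sum>x\<in>T. g x * dgen x i) - r * dgen (b \<beta>) i) \<in> N"
  using assms(1,2)
proof (induction T)
  case empty
  then show ?case using S_nonempty N_zero by (auto intro!: bexI[of _ 0])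
next
  case (insert x T)
  then obtain \<alpha> r where r: "\<alpha> \<in> S" "r \<in> B" "(\<lambda>i. (\<Sum>x\<in>T. g x * dgen x i) - r * dgen (b \<alpha>) i) \<in> N"
    by auto
  obtain \<beta> f where f: "\<beta> \<in> S" "f \<in> polys_over A" "x = poly f (b \<beta>)" using B_eq insert.prems by blast
  define \<gamma> where "\<gamma> = max \<alpha> \<beta>"
  have \<gamma>: "\<gamma> \<in> S" "\<alpha> \<le> \<gamma>" "\<beta> \<le> \<gamma>" using f(1) r(1) by (auto simp: \<gamma>_def max_def)
  define s where "s = poly (pderiv f) (b \<beta>)"
  have s: "s \<in> B"
    unfolding s_def using poly_b_in[OF f(1) pderiv_in_polys_over[OF A.type_subring_axioms f(2)]] .
  have q: "a \<alpha> / a \<gamma> \<in> B" "a \<beta> / a \<gamma> \<in> B" using a_quotient \<gamma> r(1) f(1) AB by blast+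
  have "(\<lambda>i. dgen x i - s * dgen (b \<beta>) i) \<in> N"
    unfolding s_def f(3) using f b_in by (intro dgen_poly) auto
  from raise_dgen_b[OF f(1) \<gamma>(1,3) s this]
  have "(\<lambda>i. g x * (dgen x i - s * (a \<beta> / a \<gamma>) * dgen (b \<gamma>) i)) \<in> N"
    using assms(3) by (intro N_scale)
  from N_add[OF this raise_dgen_b[OF r(1) \<gamma>(1,2) r(2,3)]]
  have "(\<lambda>i. (\<Sum>x\<in>insert x T. g x * dgen x i)
      - (g x * (s * (a \<beta> / a \<gamma>)) + r * (a \<alpha> / a \<gamma>)) * dgen (b \<gamma>) i) \<in> N"
    using insert.hyps by (simp add: algebra_simps)
  moreover have "g x * (s * (a \<beta> / a \<gamma>)) + r * (a \<alpha> / a \<gamma>) \<in> B"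
    using q s r(2) assms(3) by (intro B.add_in B.mult_in)
  ultimately show ?case using \<gamma>(1) by blast
qed

text \<open>
  The heart of injectivity. If \<open>r * a \<beta> = s * a \<delta> * different \<delta>\<close> with \<open>\<beta> \<le> \<delta>\<close>, then cancelling \<open>a \<delta>\<close> gives
  \<open>r * d (b \<beta>) = r * (a \<beta> / a \<delta>) * d (b \<delta>) = s * different \<delta> * d (b \<delta>)\<close>, which is
  \<open>s * d (h \<delta> (b \<delta>)) = s * d 0 = 0\<close>.
\<close>

lemma dgen_b_in_N:
  assumes "\<beta> \<in> S" "r \<in> B" "r * a \<beta> \<in> W"
  shows "(\<lambda>i. r * dgen (b \<beta>) i) \<in> N"
proof -
  obtain s \<delta> where s: "s \<in> B" "\<delta> \<in> S" "\<beta> \<le> \<delta>" "r * a \<beta> = s * (a \<delta> * different \<delta>)"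
    using W.directed_idealE[OF assms(3,1)] .
  have eq: "r * (a \<beta> / a \<delta>) = s * different \<delta>"
    using s(4) a_nonzero[OF s(2)] by (simp add: field_simps)
  have "(\<lambda>i. dgen 0 i - different \<delta> * dgen (b \<delta>) i) \<in> N"
    using dgen_poly[OF h_in[OF s(2)] b_in[OF s(2)]] h_root[OF s(2)] by (simp add: different_def)
  from N_diff[OF N_dgen_const[OF A.zero_in] this]
  have "(\<lambda>i. s * (different \<delta> * dgen (b \<delta>) i)) \<in> N" by (intro N_scale[OF s(1)]) simp
  moreover have "(\<lambda>i. r * (dgen (b \<beta>) i - a \<beta> / a \<delta> * dgen (b \<delta>) i)) \<in> N"
    by (rule N_scale[OF assms(2) dgen_b[OF assms(1) s(2,3)]])
  ultimately have "(\<lambda>i. s * (different \<delta> * dgen (b \<delta>) i) +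
      r * (dgen (b \<beta>) i - a \<beta> / a \<delta> * dgen (b \<delta>) i)) \<in> N"
    by (rule N_add)
  moreover have "s * (different \<delta> * y) + r * (x - a \<beta> / a \<delta> * y) = r * x" for x y
  proof -
    have "s * (different \<delta> * y) = r * (a \<beta> / a \<delta>) * y" by (simp only: eq mult.assoc)
    then show ?thesis by (simp add: algebra_simps)
  qed
  ultimately show ?thesis by simp
qed

text \<open>
  Modulo \<open>N\<close> the element \<open>g\<close> is a multiple of a single \<open>d (b \<beta>)\<close>, and \<open>evaluate\<close> sends the elements of
  \<open>N\<close> into \<open>W\<close>, so the claim reduces to that multiple, where \<open>dgen_b_in_N\<close> applies.
\<close>

lemma evaluate_in_W_imp_in_N:
  assumes g: "\<And>i. g i \<in> B" "\<And>i. i \<notin> B \<Longrightarrow> g i = 0" "finite {i. g i \<noteq> 0}"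
    and eval_g: "evaluate g \<in> W" and eval_N: "\<And>f. f \<in> N \<Longrightarrow> evaluate f \<in> W"
  shows "g \<in> N"
proof -
  have g_sum: "(\<Sum>x | g x \<noteq> 0. g x * dgen x i) = g i" for i
  proof -
    have "(\<Sum>x | g x \<noteq> 0. g x * dgen x i) = (\<Sum>x | g x \<noteq> 0. if x = i then g x else 0)"
      by (intro sum.cong) (auto simp: dgen_def)
    then show ?thesis using g(3) by simp
  qed
  obtain \<beta> r where r: "\<beta> \<in> S" "r \<in> B" "(\<lambda>i. g i - r * dgen (b \<beta>) i) \<in> N"
    using reduce_to_dgen_b[of "{x. g x \<noteq> 0}" g] g unfolding g_sum by blast
  have fin: "finite {i. r * dgen (b \<beta>) i \<noteq> 0}"
    by (rule finite_subset[OF _ finite_dgen[of "b \<beta>"]]) auto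
  have "evaluate g - r * deriv_lift (b \<beta>) \<in> W"
    using eval_N[OF r(3)] g(3) fin by (simp add: evaluate_diff evaluate_scale evaluate_dgen)
  from W.diff_in_directed_ideal[OF eval_g this] have "r * deriv_lift (b \<beta>) \<in> W" by simp
  from W.diff_in_directed_ideal[OF this W.mult_in_directed_ideal[OF r(2) deriv_lift_b[OF r(1)]]]
  have "r * a \<beta> \<in> W" by (simp add: algebra_simps)
  from N_add[OF r(3) dgen_b_in_N[OF r(1,2) this]] show "g \<in> N" by simp
qed

end

section \<open>Kaehler differentials of a monogenic tower\<close>

context directed_generators
begin

lemma directed_ideal_is_ideal:
  assumes R: "R = ring_of_type_algebra\<lparr>carrier := B\<rparr>" "cring R"
  shows "ideal (directed_ideal B S g) R"
proof -
  interpret cring R by fact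
  show ?thesis
  proof (rule idealI)
    show "subgroup (directed_ideal B S g) (add_monoid R)"
    proof (rule add.subgroupI)
      show "directed_ideal B S g \<noteq> {}" using zero_in_directed_ideal by blast
      show "\<ominus>\<^bsub>R\<^esub> x \<in> directed_ideal B S g" if x: "x \<in> directed_ideal B S g" for x
      proof -
        have "\<ominus>\<^bsub>R\<^esub> x = - x"
          using x directed_ideal_subset by (intro minus_equality) (auto simp: R(1))
        then show ?thesis
          using mult_in_directed_ideal[OF uminus_in[OF one_in] x] by simp
      qed
    qed (use directed_ideal_subset add_in_directed_ideal in \<open>auto simp: R(1)\<close>)
    show "x \<otimes>\<^bsub>R\<^esub> y \<in> directed_ideal B S g" "y \<otimes>\<^bsub>R\<^esub> x \<in> directed_ideal B S g"
      if "y \<in> directed_ideal B S g" "x \<in> carrier R" for x y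
      using mult_in_directed_ideal[of x y] that by (simp_all add: R(1) mult.commute)
  qed (rule ring_axioms)
qed

lemma genideal_directed:
  assumes R: "R = ring_of_type_algebra\<lparr>carrier := B\<rparr>" "cring R"
  shows "genideal R (g ` S) = directed_ideal B S g"
proof -
  interpret cring R by fact
  interpret I: ideal "genideal R (g ` S)" R
    by (rule genideal_ideal) (use g_in in \<open>auto simp: R(1)\<close>)
  show ?thesis
  proof
    show "genideal R (g ` S) \<subseteq> directed_ideal B S g"
      by (rule genideal_minimal[OF directed_ideal_is_ideal[OF R]])
        (auto intro!: directed_idealI[OF one_in])
    have "g ` S \<subseteq> genideal R (g ` S)" by (rule genideal_self) (use g_in in \<open>auto simp: R(1)\<close>)
    then show "directed_ideal B S g \<subseteq> genideal R (g ` S)"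
      using I.I_l_closed by (auto simp: directed_ideal_def R(1))
  qed
qed

end

context monogenic_tower
begin

lemma ideal_prod_U_V:
  assumes R: "R = ring_of_type_algebra\<lparr>carrier := B\<rparr>"
  shows "ideal_prod R U V = W"
proof
  show "ideal_prod R U V \<subseteq> W"
  proof
    fix x assume "x \<in> ideal_prod R U V"
    then show "x \<in> W"
      by induction (auto simp: R intro: mult_U_V W.add_in_directed_ideal)
  qed
  show "W \<subseteq> ideal_prod R U V"
  proof
    fix x assume "x \<in> W"
    then obtain s \<delta> where s: "s \<in> B" "\<delta> \<in> S" "x = s * (a \<delta> * different \<delta>)"
      by (auto simp: directed_ideal_def)
    have "s * a \<delta> \<in> U" using s by (intro directed_idealI[of s]) auto
    moreover have "different \<delta> \<in> V" using s by (intro directed_idealI[of 1]) auto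
    ultimately have "(s * a \<delta>) \<otimes>\<^bsub>R\<^esub> different \<delta> \<in> ideal_prod R U V" by (rule ideal_prod.prod)
    then show "x \<in> ideal_prod R U V" by (simp add: s R mult.assoc)
  qed
qed

lemma free_module_simps:
  assumes R: "R = ring_of_type_algebra\<lparr>carrier := B\<rparr>"
  shows "carrier (free_module R B) = {f. (\<forall>i. f i \<in> B) \<and> (\<forall>i. i \<notin> B \<longrightarrow> f i = 0) \<and> finite {i. f i \<noteq> 0}}"
    and "ring.zero (free_module R B) = (\<lambda>i. 0)"
    and "f \<oplus>\<^bsub>free_module R B\<^esub> g = (\<lambda>i. f i + g i)"
    and "r \<odot>\<^bsub>free_module R B\<^esub> f = (\<lambda>i. r * f i)"
    and "free_gen R x = dgen x"
  by (auto simp: free_module_def free_gen_def dgen_def R)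

lemma free_module_minus:
  assumes R: "R = ring_of_type_algebra\<lparr>carrier := B\<rparr>" "cring R"
    and fg: "f \<in> carrier (free_module R B)" "g \<in> carrier (free_module R B)"
  shows "f \<ominus>\<^bsub>free_module R B\<^esub> g = (\<lambda>i. f i - g i)"
proof -
  interpret F: Module.module R "free_module R B" by (rule free_module_is_module[OF R(2)])
  let ?F = "free_module R B"
  have "(\<lambda>i. - g i) \<in> carrier ?F" using fg(2) unfolding free_module_simps[OF R(1)] by auto
  moreover have "(\<lambda>i. - g i) \<oplus>\<^bsub>?F\<^esub> g = ring.zero ?F" by (simp add: free_module_simps[OF R(1)])
  ultimately have "\<ominus>\<^bsub>?F\<^esub> g = (\<lambda>i. - g i)" using fg(2) by (intro F.M.minus_equality) auto
  then show ?thesis by (simp add: a_minus_def free_module_simps(3)[OF R(1)])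
qed

lemma dgen_in_free_module:
  assumes R: "R = ring_of_type_algebra\<lparr>carrier := B\<rparr>" and "x \<in> B"
  shows "dgen x \<in> carrier (free_module R B)"
  unfolding free_module_simps[OF R(1)] using assms(2) by (auto simp: dgen_def)

lemma kaehler_relations_eq:
  assumes R: "R = ring_of_type_algebra\<lparr>carrier := B\<rparr>" "cring R"
  shows "kaehler_relations R A =
    {\<lambda>i. dgen (x + y) i - (dgen x i + dgen y i) | x y. x \<in> B \<and> y \<in> B} \<union>
    {\<lambda>i. dgen (x * y) i - (x * dgen y i + y * dgen x i) | x y. x \<in> B \<and> y \<in> B} \<union> dgen ` A"
proof -
  let ?F = "free_module R B"
  interpret F: Module.module R ?F by (rule free_module_is_module[OF R(2)])
  have carrR: "carrier R = B" by (simp add: R(1))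
  note d = dgen_in_free_module[OF R(1)]
  have 1: "free_gen R (x \<oplus>\<^bsub>R\<^esub> y) \<ominus>\<^bsub>?F\<^esub> (free_gen R x \<oplus>\<^bsub>?F\<^esub> free_gen R y)
      = (\<lambda>i. dgen (x + y) i - (dgen x i + dgen y i))" if "x \<in> B" "y \<in> B" for x y
  proof -
    have "free_gen R (x \<oplus>\<^bsub>R\<^esub> y) \<ominus>\<^bsub>?F\<^esub> (free_gen R x \<oplus>\<^bsub>?F\<^esub> free_gen R y)
        = dgen (x + y) \<ominus>\<^bsub>?F\<^esub> (dgen x \<oplus>\<^bsub>?F\<^esub> dgen y)"
      by (simp add: free_module_simps(5)[OF R(1)]) (simp add: R(1))
    also have "\<dots> = (\<lambda>i. dgen (x + y) i - (dgen x \<oplus>\<^bsub>?F\<^esub> dgen y) i)"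
      using that by (intro free_module_minus[OF R] F.M.add.m_closed d B.add_in)
    finally show ?thesis by (simp add: free_module_simps(3)[OF R(1)])
  qed
  have 2: "free_gen R (x \<otimes>\<^bsub>R\<^esub> y) \<ominus>\<^bsub>?F\<^esub> (x \<odot>\<^bsub>?F\<^esub> free_gen R y \<oplus>\<^bsub>?F\<^esub> y \<odot>\<^bsub>?F\<^esub> free_gen R x)
      = (\<lambda>i. dgen (x * y) i - (x * dgen y i + y * dgen x i))" if "x \<in> B" "y \<in> B" for x y
  proof -
    have "free_gen R (x \<otimes>\<^bsub>R\<^esub> y) \<ominus>\<^bsub>?F\<^esub> (x \<odot>\<^bsub>?F\<^esub> free_gen R y \<oplus>\<^bsub>?F\<^esub> y \<odot>\<^bsub>?F\<^esub> free_gen R x)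
        = dgen (x * y) \<ominus>\<^bsub>?F\<^esub> (x \<odot>\<^bsub>?F\<^esub> dgen y \<oplus>\<^bsub>?F\<^esub> y \<odot>\<^bsub>?F\<^esub> dgen x)"
      by (simp add: free_module_simps(5)[OF R(1)]) (simp add: R(1))
    also have "\<dots> = (\<lambda>i. dgen (x * y) i - (x \<odot>\<^bsub>?F\<^esub> dgen y \<oplus>\<^bsub>?F\<^esub> y \<odot>\<^bsub>?F\<^esub> dgen x) i)"
      using that carrR
      by (intro free_module_minus[OF R] F.M.add.m_closed F.smult_closed d B.mult_in) auto
    finally show ?thesis by (simp add: free_module_simps(3,4)[OF R(1)])
  qed
  have "free_gen R ` A = dgen ` A" by (simp add: free_module_simps(5)[OF R(1)])
  then show ?thesis
    unfolding kaehler_relations_def Let_def carrR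
    by (intro arg_cong2[of _ _ _ _ "(\<union>)"] Collect_cong ex_cong1) (auto simp: 1 2)
qed

text \<open>
  As a submodule, this preimage contains everything that the relations generate once it contains
  the relations themselves.
\<close>

lemma submodule_evaluate_vimage:
  assumes R: "R = ring_of_type_algebra\<lparr>carrier := B\<rparr>" "cring R"
  shows "submodule {f \<in> carrier (free_module R B). evaluate f \<in> W} R (free_module R B)"
proof -
  let ?F = "free_module R B"
  interpret F: Module.module R ?F by (rule free_module_is_module[OF R(2)])
  have fin: "finite {i. f i \<noteq> 0}" if "f \<in> carrier ?F" for f
    using that by (simp add: free_module_simps(1)[OF R(1)])
  have scale: "r \<odot>\<^bsub>?F\<^esub> f \<in> {f \<in> carrier ?F. evaluate f \<in> W}"
    if "r \<in> carrier R" "f \<in> {f \<in> carrier ?F. evaluate f \<in> W}" for r f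
    using that F.smult_closed[of r f] W.mult_in_directed_ideal[of r "evaluate f"]
    by (simp add: free_module_simps(4)[OF R(1)] evaluate_scale fin) (simp add: R(1))
  show ?thesis
  proof (rule F.submoduleI)
    show "\<zero>\<^bsub>?F\<^esub> \<in> {f \<in> carrier ?F. evaluate f \<in> W}"
      using F.M.zero_closed W.zero_in_directed_ideal
      by (simp add: free_module_simps(2)[OF R(1)] evaluate_def)
    show "f \<oplus>\<^bsub>?F\<^esub> g \<in> {f \<in> carrier ?F. evaluate f \<in> W}"
      if "f \<in> {f \<in> carrier ?F. evaluate f \<in> W}" "g \<in> {f \<in> carrier ?F. evaluate f \<in> W}" for f g
      using that F.M.add.m_closed[of f g] W.add_in_directed_ideal
      by (simp add: free_module_simps(3)[OF R(1)] evaluate_add fin)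
    show "\<ominus>\<^bsub>?F\<^esub> f \<in> {f \<in> carrier ?F. evaluate f \<in> W}" if f: "f \<in> {f \<in> carrier ?F. evaluate f \<in> W}" for f
    proof -
      have "\<ominus>\<^bsub>R\<^esub> \<one>\<^bsub>R\<^esub> \<odot>\<^bsub>?F\<^esub> f = \<ominus>\<^bsub>?F\<^esub> f" using f by (simp add: F.smult_l_minus)
      then show ?thesis using scale[of "\<ominus>\<^bsub>R\<^esub> \<one>\<^bsub>R\<^esub>" f] f by simp
    qed
  qed (use scale in auto)
qed

lemma evaluate_kaehler_relation:
  assumes R: "R = ring_of_type_algebra\<lparr>carrier := B\<rparr>" "cring R" and "f \<in> kaehler_relations R A"
  shows "evaluate f \<in> W"
proof -
  have fin_add: "finite {i. f i + g i \<noteq> 0}"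
    if "finite {i. f i \<noteq> 0}" "finite {i. g i \<noteq> 0}" for f g :: "'l \<Rightarrow> 'l"
    by (rule finite_subset[OF _ finite_UnI[OF that]]) auto
  have fin_scale: "finite {i. r * dgen x i \<noteq> 0}" for r x
    by (rule finite_subset[OF _ finite_dgen[of x]]) auto
  show ?thesis
    using assms(3) deriv_lift_add deriv_lift_mult deriv_lift_const
    by (auto simp: kaehler_relations_eq[OF R] evaluate_diff evaluate_add evaluate_scale evaluate_dgen
        fin_add fin_scale)
qed

text \<open>
  The map \<open>evaluate\<close> from the free module to \<open>U\<close> is onto modulo \<open>W\<close>, because it sends \<open>d (b \<beta>)\<close> to
  \<open>a \<beta>\<close> up to \<open>W\<close>, and the submodule generated by the relations is exactly the preimage of \<open>W\<close>.
\<close>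

lemma kaehler_isomorphic:
  assumes R: "R = ring_of_type_algebra\<lparr>carrier := B\<rparr>" "cring R"
  shows "module_isomorphic R (kaehler R A) (quot_module (ideal_module R U) W)"
proof -
  let ?F = "free_module R B"
  have carrR: "carrier R = B" by (simp add: R(1))
  interpret R: cring R by fact
  interpret F: Module.module R ?F by (rule free_module_is_module[OF R(2)])
  have U: "ideal U R" by (rule U.directed_ideal_is_ideal[OF R])
  have V: "ideal V R" by (rule V.directed_ideal_is_ideal[OF R])
  have W: "submodule W R (ideal_module R U)"
    using ideal_prod_is_submodule[OF R(2) U V] by (simp add: ideal_prod_U_V[OF R(1)])
  interpret UM: Module.module R "ideal_module R U" by (rule ideal_module_is_module[OF R(2) U])
  define N where "N = submodule_gen R ?F (kaehler_relations R A)"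
  have rel_F: "kaehler_relations R A \<subseteq> carrier ?F"
  proof -
    note d = dgen_in_free_module[OF R(1)]
    have "f \<in> carrier ?F \<Longrightarrow> g \<in> carrier ?F \<Longrightarrow> (\<lambda>i. f i - g i) \<in> carrier ?F" for f g
      using F.M.minus_closed[of f g] by (simp add: free_module_minus[OF R])
    moreover have "f \<in> carrier ?F \<Longrightarrow> g \<in> carrier ?F \<Longrightarrow> (\<lambda>i. f i + g i) \<in> carrier ?F" for f g
      using F.M.add.m_closed[of f g] by (simp add: free_module_simps(3)[OF R(1)])
    moreover have "r \<in> B \<Longrightarrow> g \<in> carrier ?F \<Longrightarrow> (\<lambda>i. r * g i) \<in> carrier ?F" for r g
      using F.smult_closed[of r g] by (simp add: free_module_simps(4)[OF R(1)] carrR)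
    ultimately show ?thesis
      using d AB unfolding kaehler_relations_eq[OF R] by (auto simp: B.add_in B.mult_in subset_iff)
  qed
  have N_sub: "submodule N R ?F"
    unfolding N_def by (rule submodule_gen_is_submodule[OF F.module_axioms rel_F])
  have N_rel: "f \<in> N" if "f \<in> kaehler_relations R A" for f
    using that by (auto simp: N_def submodule_gen_def)
  have N_W: "f \<in> carrier ?F \<and> evaluate f \<in> W" if "f \<in> N" for f
  proof -
    have "kaehler_relations R A \<subseteq> {f \<in> carrier ?F. evaluate f \<in> W}"
      using rel_F evaluate_kaehler_relation[OF R] by auto
    then show ?thesis
      using that submodule_evaluate_vimage[OF R] unfolding N_def submodule_gen_def by blast
  qed
  interpret N: differential_relations A B K S a b h N
  proof
    show "(\<lambda>_. 0) \<in> N"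
      using F.submoduleE(2)[OF N_sub] submodule.axioms(1)[OF N_sub, THEN subgroup.one_closed]
      by (simp add: free_module_simps[OF R(1)])
    show "(\<lambda>i. f i + g i) \<in> N" if "f \<in> N" "g \<in> N" for f g
      using F.submoduleE(5)[OF N_sub that] by (simp add: free_module_simps[OF R(1)])
    show "(\<lambda>i. r * f i) \<in> N" if "r \<in> B" "f \<in> N" for r f
      using F.submoduleE(4)[OF N_sub, of r f] that by (simp add: free_module_simps[OF R(1)] carrR)
    show "(\<lambda>i. dgen (x + y) i - (dgen x i + dgen y i)) \<in> N"
      "(\<lambda>i. dgen (x * y) i - (x * dgen y i + y * dgen x i)) \<in> N" if "x \<in> B" "y \<in> B" for x y
      by (rule N_rel, unfold kaehler_relations_eq[OF R], use that in blast)+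
    show "dgen x \<in> N" if "x \<in> A" for x
      by (rule N_rel, unfold kaehler_relations_eq[OF R], use that in blast)
  qed
  show ?thesis
    unfolding kaehler_def Let_def carrR N_def[symmetric]
  proof (rule module_isomorphic_quot_module[OF F.module_axioms UM.module_axioms W, where \<phi> = evaluate])
    show "evaluate f \<in> carrier (ideal_module R U)" if "f \<in> carrier ?F" for f
      using that evaluate_in_U by (simp add: free_module_simps(1)[OF R(1)] ideal_module_def)
    show "evaluate (f \<oplus>\<^bsub>?F\<^esub> g) = evaluate f \<oplus>\<^bsub>ideal_module R U\<^esub> evaluate g"
      if "f \<in> carrier ?F" "g \<in> carrier ?F" for f g
      using that by (simp add: free_module_simps[OF R(1)] ideal_module_def evaluate_add) (simp add: R(1))
    show "evaluate (r \<odot>\<^bsub>?F\<^esub> f) = r \<odot>\<^bsub>ideal_module R U\<^esub> evaluate f"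
      if "r \<in> carrier R" "f \<in> carrier ?F" for r f
      using that by (simp add: free_module_simps[OF R(1)] ideal_module_def evaluate_scale) (simp add: R(1))
    show "submodule N R ?F" by (rule N_sub)
    show "f \<in> N \<longleftrightarrow> evaluate f \<in> W" if "f \<in> carrier ?F" for f
      using that N.evaluate_in_W_imp_in_N[of f] N_W by (auto simp: free_module_simps(1)[OF R(1)])
    show "\<exists>f\<in>carrier ?F. u \<in> W +>\<^bsub>ideal_module R U\<^esub> evaluate f" if u: "u \<in> carrier (ideal_module R U)" for u
    proof -
      obtain r \<beta> where r: "r \<in> B" "\<beta> \<in> S" "u = r * a \<beta>"
        using u by (auto simp: ideal_module_def directed_ideal_def)
      define f where "f = (\<lambda>i. r * dgen (b \<beta>) i)"
      have f: "f \<in> carrier ?F"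
        using F.smult_closed[of r "dgen (b \<beta>)"] r dgen_in_free_module[OF R(1) b_in]
        by (simp add: f_def carrR free_module_simps(4)[OF R(1)])
      have ev: "evaluate f = r * deriv_lift (b \<beta>)"
        unfolding f_def by (simp add: evaluate_scale evaluate_dgen)
      have "r * (-1 * (deriv_lift (b \<beta>) - a \<beta>)) \<in> W"
        using r deriv_lift_b B.uminus_in[OF B.one_in] by (intro W.mult_in_directed_ideal) auto
      moreover have "u = r * (-1 * (deriv_lift (b \<beta>) - a \<beta>)) \<oplus>\<^bsub>ideal_module R U\<^esub> evaluate f"
        by (simp add: r(3) ev ideal_module_def R(1) algebra_simps)
      ultimately show ?thesis using f unfolding a_r_coset_def' by blast
    qed
  qed
qed

end

lemma mem_simple_extensionD:
  fixes A :: "'a::field set"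
  assumes "type_subring A" "x \<in> ring.simple_extension ring_of_type_algebra A b"
  shows "\<exists>f\<in>polys_over A. x = poly f b"
proof -
  interpret type_subring A by fact
  interpret L: Ring.field "ring_of_type_algebra :: 'a ring" by (rule field_from_type_algebra)
  show ?thesis
    using assms(2)
  proof (induction rule: L.simple_extension.induct)
    case zero
    then show ?case by (auto intro!: bexI[of _ 0])
  next
    case (lin y k)
    then obtain f where "f \<in> polys_over A" "y = poly f b" by blast
    then show ?case using lin.hyps by (intro bexI[of _ "pCons k f"]) (auto simp: algebra_simps)
  qed
qed

section \<open>Integral extensions that are unions of monogenic ones\<close>

theorem theorem1p1:
  fixes L :: "'l::field ring" and K A B :: "'l set" and n :: nat
    and S :: "'s::linorder set" and a b :: "'s \<Rightarrow> 'l"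
  assumes L: "L = ring_of_type_algebra"
    and K: "subfield K L"
    and algebraic: "\<And>x. x \<in> carrier L \<Longrightarrow> (ring.algebraic L over K) x"
    and degree: "ring.dimension L n K (carrier L)"
    and A: "normal_subdomain L A" "quotient_field L A = K"
    and B: "subdomain B L" "quotient_field L B = carrier L"
    and AB: "A \<subseteq> B" "\<And>x. x \<in> B \<Longrightarrow> integral_over L A x"
    and b: "\<And>\<alpha>. \<alpha> \<in> S \<Longrightarrow> b \<alpha> \<in> B"
      "\<And>\<alpha>. \<alpha> \<in> S \<Longrightarrow> generate_field L (K \<union> {b \<alpha>}) = carrier L"
      "\<And>\<alpha> \<beta>. \<alpha> \<in> S \<Longrightarrow> \<beta> \<in> S \<Longrightarrow> \<alpha> \<le> \<beta> \<Longrightarrow>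
        ring.simple_extension L A (b \<alpha>) \<subseteq> ring.simple_extension L A (b \<beta>)"
      "(\<Union>\<alpha>\<in>S. ring.simple_extension L A (b \<alpha>)) = B"
    and a: "\<And>\<alpha>. \<alpha> \<in> S \<Longrightarrow> a \<alpha> \<in> A" "\<And>\<alpha>. \<alpha> \<in> S \<Longrightarrow> a \<alpha> \<noteq> 0"
      "\<And>\<alpha> \<beta>. \<alpha> \<in> S \<Longrightarrow> \<beta> \<in> S \<Longrightarrow> \<alpha> \<le> \<beta> \<Longrightarrow> a \<beta> divides\<^bsub>L\<lparr>carrier := A\<rparr>\<^esub> a \<alpha>"
    and c: "\<And>\<alpha> \<beta>. \<alpha> \<in> S \<Longrightarrow> \<beta> \<in> S \<Longrightarrow> \<alpha> \<le> \<beta> \<Longrightarrow>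
        \<exists>c\<in>A. b \<alpha> = a \<alpha> / a \<beta> * b \<beta> + c"
    and R: "R = L\<lparr>carrier := B\<rparr>"
    and U: "U = genideal R (a ` S)"
    and V: "V = genideal R ((\<lambda>\<alpha>. poly (pderiv (minimal_poly K (b \<alpha>))) (b \<alpha>)) ` S)"
  shows "module_isomorphic R (kaehler R A) (quot_module (ideal_module R U) (ideal_prod R U V))"
proof -
  interpret L: Ring.field "ring_of_type_algebra :: 'l ring" by (rule field_from_type_algebra)
  note assms' = K[unfolded L] A[unfolded L] B(1)[unfolded L] AB(2)[unfolded L]
  note alg = algebraic[unfolded L, simplified]
  have subA: "subring A ring_of_type_algebra" "subring B ring_of_type_algebra"
    using assms'(2,4) subdomainE(1)
    by (auto simp: normal_subdomain_def subdomain_def subcring_def)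
  have R': "R = ring_of_type_algebra\<lparr>carrier := B\<rparr>" by (simp add: R L)
  have "cring R"
    using L.subdomain_is_domain[OF assms'(4)] by (simp add: R' domain_def)
  interpret A: type_subring A by (rule type_subring_if_subring[OF subA(1)])
  interpret B: type_subring B by (rule type_subring_if_subring[OF subA(2)])
  interpret K: type_subring K by (rule type_subring_if_subring[OF subfieldE(1)[OF assms'(1)]])
  have AK: "A \<subseteq> K"
    using subset_quotient_field[OF A.type_subring_axioms] assms'(3) by simp
  interpret monogenic_tower A B K S a b "\<lambda>\<alpha>. minimal_poly K (b \<alpha>)"
  proof
    show "inverse x \<in> K" if "x \<in> K" for x
    proof (cases "x = 0")
      case False
      then show ?thesis
        using L.subfield_m_inv(1)[OF assms'(1), of x] that by (simp add: m_inv_type_algebra)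
    qed auto
    show "\<exists>\<alpha>\<in>S. \<exists>f\<in>polys_over A. x = poly f (b \<alpha>)" if "x \<in> B" for x
      using that mem_simple_extensionD[OF A.type_subring_axioms] unfolding b(4)[symmetric] L by blast
    show "a \<alpha> / a \<beta> \<in> A" if "\<alpha> \<in> S" "\<beta> \<in> S" "\<alpha> \<le> \<beta>" for \<alpha> \<beta>
      using a(3)[OF that] a(2)[OF that(2)] by (auto simp: factor_def L)
    show "minimal_poly K (b \<alpha>) \<in> polys_over A" if "\<alpha> \<in> S" for \<alpha>
      using minimal_poly_in_polys_over_normal[OF assms'(1-3) assms'(5)[OF b(1)[OF that]]] alg by blast
  qed (use AB AK b a c lead_coeff_minimal_poly[OF assms'(1) alg] poly_minimal_poly[OF assms'(1) alg]
      degree_minimal_poly_le[OF assms'(1) alg] in auto)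
  have "U = directed_ideal B S a"
    unfolding U by (rule U.genideal_directed[OF R' \<open>cring R\<close>])
  moreover have "V = directed_ideal B S different"
    unfolding V different_def[symmetric] by (rule V.genideal_directed[OF R' \<open>cring R\<close>])
  ultimately show ?thesis
    using kaehler_isomorphic[OF R' \<open>cring R\<close>] ideal_prod_U_V[OF R'] by simp
qed

end
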